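(* Let $\Gamma$ be a finitely generated periodic group of orientation preserving $C^1$-diffeomorphisms of $\mathbb{S}^2$. If $\Gamma$ has a non-trivial center $Z(\Gamma)$, then $\Gamma$ is finite.
   Context: A group $\Gamma$ is periodic if every $g\in\Gamma$ has finite order, i.e. there is a positive integer $n$ with $g^n=\mathrm{id}$. A group of $C^1$-diffeomorphisms of $\mathbb{S}^2$ is a subgroup of the group of all $C^1$-diffeomorphisms of $\mathbb{S}^2$. $Z(\Gamma)=\{f\in\Gamma: fg=gf \text{ for all } g\in\Gamma\}$. *)

theory Defs
  imports "HOL-Analysis.Analysis" "HOL-Algebra.Bij" "HOL-Algebra.Generated_Groups"
begin

definition finitely_generated_group :: "('a, 'b) monoid_scheme \<Rightarrow> bool" where
  "finitely_generated_group G \<longleftrightarrow>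
     (\<exists>A. finite A \<and> A \<subseteq> carrier G \<and> generate G A = carrier G)"

definition periodic_group :: "('a, 'b) monoid_scheme \<Rightarrow> bool" where
  "periodic_group G \<longleftrightarrow>
     (\<forall>g\<in>carrier G. \<exists>n::nat. n > 0 \<and> g [^]\<^bsub>G\<^esub> n = \<one>\<^bsub>G\<^esub>)"

definition group_center :: "('a, 'b) monoid_scheme \<Rightarrow> 'a set" where
  "group_center G = {f \<in> carrier G. \<forall>g\<in>carrier G. f \<otimes>\<^bsub>G\<^esub> g = g \<otimes>\<^bsub>G\<^esub> f}"

text \<open>
  A map on a subset \<open>S\<close> of a Euclidean space is \<open>C\<^sup>1\<close> if around every point of \<open>S\<close> it extends
  to a \<open>C\<^sup>1\<close> map on an open subset of the ambient space. For an embedded submanifold such as the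
  sphere this agrees with being \<open>C\<^sup>1\<close> in charts.
\<close>

definition C1_on :: "'a::euclidean_space set \<Rightarrow> ('a \<Rightarrow> 'b::euclidean_space) \<Rightarrow> bool" where
  "C1_on S f \<longleftrightarrow>
     (\<forall>x\<in>S. \<exists>U F F'. open U \<and> x \<in> U \<and> (\<forall>y\<in>U \<inter> S. F y = f y) \<and>
        (\<forall>y\<in>U. (F has_derivative blinfun_apply (F' y)) (at y)) \<and>
        continuous_on U (F' :: 'a \<Rightarrow> 'a \<Rightarrow>\<^sub>L 'b))"

definition C1_diffeos :: "'a::euclidean_space set \<Rightarrow> ('a \<Rightarrow> 'a) set" where
  "C1_diffeos S = {f \<in> Bij S. C1_on S f \<and> C1_on S (inv_into S f)}"

text \<open>
  As in \<^const>\<open>BijGroup\<close>, diffeomorphisms are represented by functions that are undefined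
  outside \<open>S\<close>, so that equality of group elements is equality on \<open>S\<close>.
\<close>

definition Diff1 :: "'a::euclidean_space set \<Rightarrow> ('a \<Rightarrow> 'a) monoid" where
  "Diff1 S = (BijGroup S)\<lparr>carrier := C1_diffeos S\<rparr>"

abbreviation S2 :: "(real^3) set" where
  "S2 \<equiv> sphere 0 1"

text \<open>
  The tangent plane of the sphere at \<open>x\<close> is the orthogonal complement of \<open>x\<close>, and a basis
  \<open>(u, v)\<close> of it is positively oriented (with respect to the outward normal) iff
  \<open>det (x, u, v) > 0\<close>. A derivative \<open>D\<close> within the sphere is not unique as a linear map of the
  ambient space, but its restriction to the tangent plane is unique, and it maps that plane into
  the tangent plane at \<open>f x\<close>.
\<close>

definition orientation_preserving :: "(real^3 \<Rightarrow> real^3) \<Rightarrow> bool" where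
  "orientation_preserving f \<longleftrightarrow>
     (\<forall>x\<in>S2. \<exists>D. (f has_derivative D) (at x within S2) \<and>
        (\<forall>u v. u \<bullet> x = 0 \<and> v \<bullet> x = 0 \<and> det (vector [x, u, v] :: real^3^3) > 0 \<longrightarrow>
           det (vector [f x, D u, D v] :: real^3^3) > 0))"

lemma C1_on_compose:
  assumes f: "C1_on S f" and g: "C1_on T g" and fS: "f ` S \<subseteq> T"
  shows "C1_on S (\<lambda>x. g (f x))"
  unfolding C1_on_def
proof
  fix x assume x: "x \<in> S"
  obtain U F F' where U: "open U" "x \<in> U" "\<forall>y\<in>U \<inter> S. F y = f y"
    "\<forall>y\<in>U. (F has_derivative blinfun_apply (F' y)) (at y)" "continuous_on U F'"
    using f x unfolding C1_on_def by meson
  have "f x \<in> T" using x fS by auto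
  then obtain V G G' where V: "open V" "f x \<in> V" "\<forall>y\<in>V \<inter> T. G y = g y"
    "\<forall>y\<in>V. (G has_derivative blinfun_apply (G' y)) (at y)" "continuous_on V G'"
    using g unfolding C1_on_def by meson
  have cF: "continuous_on U F"
    using U(4) by (meson differentiableI differentiable_at_imp_differentiable_on
        differentiable_imp_continuous_on)
  let ?W = "U \<inter> F -` V"
  have W: "open ?W"
    using cF U(1) V(1) by (metis continuous_on_open_vimage Int_commute)
  have "F x = f x" using U x by auto
  then have xW: "x \<in> ?W" using U(2) V(2) by auto
  have eq: "\<forall>y\<in>?W \<inter> S. G (F y) = g (f y)"
    using U(3) V(3) fS by auto
  have der: "\<forall>y\<in>?W. ((\<lambda>y. G (F y)) has_derivative blinfun_apply (G' (F y) o\<^sub>L F' y)) (at y)"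
  proof
    fix y assume y: "y \<in> ?W"
    have "(G \<circ> F has_derivative blinfun_apply (G' (F y)) \<circ> blinfun_apply (F' y)) (at y)"
      using y U(4) V(4) by (intro diff_chain_at) auto
    then show "((\<lambda>y. G (F y)) has_derivative blinfun_apply (G' (F y) o\<^sub>L F' y)) (at y)"
      by (simp add: o_def blinfun_compose.rep_eq)
  qed
  have "continuous_on ?W (\<lambda>y. G' (F y))"
    by (rule continuous_on_compose2[OF V(5)]) (auto intro: continuous_on_subset[OF cF])
  then have "continuous_on ?W (\<lambda>y. G' (F y) o\<^sub>L F' y)"
    by (intro continuous_intros) (auto intro: continuous_on_subset[OF U(5)])
  with W xW eq der show "\<exists>U H H'. open U \<and> x \<in> U \<and> (\<forall>y\<in>U \<inter> S. H y = g (f y)) \<and>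
        (\<forall>y\<in>U. (H has_derivative blinfun_apply (H' y)) (at y)) \<and> continuous_on U H'"
    by (intro exI[of _ ?W] exI[of _ "\<lambda>y. G (F y)"] exI[of _ "\<lambda>y. G' (F y) o\<^sub>L F' y"]) auto
qed

lemma C1_on_cong:
  assumes "C1_on S f" "\<And>x. x \<in> S \<Longrightarrow> f x = g x"
  shows "C1_on S g"
  unfolding C1_on_def
proof
  fix x assume "x \<in> S"
  then obtain U F F' where "open U" "x \<in> U" "\<forall>y\<in>U \<inter> S. F y = f y"
    "\<forall>y\<in>U. (F has_derivative blinfun_apply (F' y)) (at y)" "continuous_on U F'"
    using assms(1) unfolding C1_on_def by meson
  then show "\<exists>U F F'. open U \<and> x \<in> U \<and> (\<forall>y\<in>U \<inter> S. F y = g y) \<and>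
        (\<forall>y\<in>U. (F has_derivative blinfun_apply (F' y)) (at y)) \<and> continuous_on U F'"
    using assms(2) by (intro exI[of _ U] exI[of _ F] exI[of _ F']) auto
qed

lemma C1_on_id: "C1_on S (\<lambda>x. x)"
  unfolding C1_on_def
  by (intro ballI exI[of _ UNIV] exI[of _ "\<lambda>x. x"] exI[of _ "\<lambda>_. id_blinfun"]) auto

lemma subgroup_C1_diffeos: "subgroup (C1_diffeos S) (BijGroup S)"
proof -
  interpret B: group "BijGroup S" by (rule group_BijGroup)
  have invB: "inv\<^bsub>BijGroup S\<^esub> f = (\<lambda>x\<in>S. inv_into S f x)" if "f \<in> Bij S" for f
    using that
    by (intro B.inv_equality)
       (auto simp: BijGroup_def Bij_compose_restrict_eq restrict_inv_into_Bij)
  show ?thesis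
  proof (rule B.subgroupI)
    show "C1_diffeos S \<subseteq> carrier (BijGroup S)"
      by (auto simp: C1_diffeos_def BijGroup_def)
    have inv_id: "inv_into S (\<lambda>x\<in>S. x) x = x" if "x \<in> S" for x
      using that by (intro inv_into_f_eq) (auto simp: inj_on_def)
    have "(\<lambda>x\<in>S. x) \<in> C1_diffeos S"
      unfolding C1_diffeos_def
      by (auto simp: id_Bij inv_id intro!: C1_on_cong[OF C1_on_id])
    then show "C1_diffeos S \<noteq> {}" by blast
  next
    fix f assume f: "f \<in> C1_diffeos S"
    then have fB: "f \<in> Bij S" and C: "C1_on S f" "C1_on S (inv_into S f)"
      by (auto simp: C1_diffeos_def)
    have bij: "bij_betw f S S" using fB by (simp add: Bij_def)
    let ?g = "\<lambda>x\<in>S. inv_into S f x"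
    have gB: "?g \<in> Bij S" using fB by (rule restrict_inv_into_Bij)
    have "C1_on S ?g" by (rule C1_on_cong[OF C(2)]) simp
    moreover have "inv_into S ?g x = f x" if "x \<in> S" for x
      using that bij gB
      by (intro inv_into_f_eq)
         (auto simp: Bij_def bij_betw_def inv_into_f_f)
    then have "C1_on S (inv_into S ?g)"
      by (intro C1_on_cong[OF C(1)]) simp
    ultimately show "inv\<^bsub>BijGroup S\<^esub> f \<in> C1_diffeos S"
      using gB by (simp add: invB fB C1_diffeos_def)
  next
    fix f g assume fg: "f \<in> C1_diffeos S" "g \<in> C1_diffeos S"
    then have B: "f \<in> Bij S" "g \<in> Bij S"
      and C: "C1_on S f" "C1_on S (inv_into S f)" "C1_on S g" "C1_on S (inv_into S g)"
      by (auto simp: C1_diffeos_def)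
    then have bij: "bij_betw f S S" "bij_betw g S S" by (auto simp: Bij_def)
    have cB: "compose S f g \<in> Bij S" using B by (rule compose_Bij)
    have "C1_on S (compose S f g)"
      by (rule C1_on_cong[OF C1_on_compose[OF C(3) C(1)]])
         (use bij in \<open>auto simp: compose_def bij_betw_def\<close>)
    moreover have "inv_into S g (inv_into S f x) = inv_into S (compose S f g) x" if "x \<in> S" for x
    proof (rule sym, rule inv_into_f_eq)
      show "inj_on (compose S f g) S" using cB by (simp add: Bij_def bij_betw_def)
      have 1: "inv_into S f x \<in> S" using that bij(1) by (metis bij_betw_def inv_into_into)
      then show 2: "inv_into S g (inv_into S f x) \<in> S"
        using bij(2) by (metis bij_betw_def inv_into_into)
      show "compose S f g (inv_into S g (inv_into S f x)) = x"
        using that 1 2 bij by (simp add: compose_def bij_betw_inv_into_right)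
    qed
    then have "C1_on S (inv_into S (compose S f g))"
      by (intro C1_on_cong[OF C1_on_compose[OF C(2) C(4)]])
         (use bij in \<open>auto simp: bij_betw_def inv_into_into\<close>)
    ultimately show "f \<otimes>\<^bsub>BijGroup S\<^esub> g \<in> C1_diffeos S"
      using B cB by (simp add: BijGroup_def C1_diffeos_def)
  qed
qed

lemma group_Diff1: "group (Diff1 S)"
  unfolding Diff1_def
  by (rule group.subgroup_imp_group[OF group_BijGroup subgroup_C1_diffeos])

end

theory Submission
  imports Defs "HOL-Complex_Analysis.Winding_Numbers"
begin

text \<open>
  Let \<open>c\<close> be a non-trivial central element. The group preserves the set of fixed points of \<open>c\<close>. This set
  is finite (\<open>finite_order_fixed_points_finite\<close>) and nonempty (\<open>conical_has_fixed_point\<close>), so the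
  stabiliser \<open>H\<close> of one of its points \<open>x\<close> has finite index. The group \<open>H\<close> turns out to be abelian, and a
  finitely generated periodic group with an abelian subgroup of finite index is finite
  (\<open>finite_if_abelian_finite_index\<close>).

  Two facts on an orientation preserving diffeomorphism of finite order that fixes \<open>x\<close> are behind this.
  If it is tangent to the identity at \<open>x\<close>, averaging its iterates shows that it is the identity near \<open>x\<close>
  (\<open>finite_order_C1_tangent_to_id\<close>). Otherwise its derivative on the tangent plane is a map of finite
  order and determinant \<open>1\<close>, conjugate to a rotation, which fixes no non-zero tangent vector, so \<open>x\<close> is an isolated
  fixed point. By connectedness of the sphere, the fixed points of a non-trivial element are finite in
  number, and \<open>H\<close> acts faithfully on the tangent plane at \<open>x\<close>.

  That \<open>H\<close> is abelian comes from hyperbolic geometry: the commutator of two elliptic elements of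
  \<open>SL(2,\<real>)\<close> has trace greater than \<open>2\<close>, hence infinite order, unless they commute
  (\<open>finite_order_commutator\<close>). In a periodic group all commutators have finite order. This takes
  the place of the theorem of Burnside and Schur on periodic linear groups.

  Existence of a fixed point is a degree argument in the stereographic plane. For a fixed-point-free
  orientation preserving diffeomorphism \<open>g\<close>, the field \<open>g z - z\<close> would wind once around a large circle and
  minus once around its only pole, with nothing in between to account for the difference
  (\<open>no_orientation_reversing_single_zero\<close>).
\<close>

section \<open>Finite order maps of the plane with determinant one\<close>

definition ctrace :: "(complex \<Rightarrow> complex) \<Rightarrow> real" where
  "ctrace T = Re (T 1) + Im (T \<i>)"

definition cdet :: "(complex \<Rightarrow> complex) \<Rightarrow> real" where
  "cdet T = Re (T 1) * Im (T \<i>) - Re (T \<i>) * Im (T 1)"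

lemma linear_complex_expand:
  assumes "linear T" shows "T w = Re w *\<^sub>R T 1 + Im w *\<^sub>R T \<i>"
proof -
  have "w = Re w *\<^sub>R 1 + Im w *\<^sub>R \<i>" by (simp add: complex_eq_iff)
  then have "T w = T (Re w *\<^sub>R 1 + Im w *\<^sub>R \<i>)" by simp
  also have "\<dots> = Re w *\<^sub>R T 1 + Im w *\<^sub>R T \<i>"
    using assms by (simp only: linear_add linear_scale)
  finally show ?thesis .
qed

lemma linear_complex_eqI:
  assumes "linear S" "linear T" "S 1 = T 1" "S \<i> = T \<i>" shows "S = T"
  using assms by (metis ext linear_complex_expand)

lemma cdet_compose:
  assumes "linear S" shows "cdet (S \<circ> T) = cdet S * cdet T"
  unfolding cdet_def o_apply
  by (subst (1 2 3 4) linear_complex_expand[OF assms]) (simp add: algebra_simps)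

lemma cdet_id [simp]: "cdet id = 1" by (simp add: cdet_def)

lemma Cayley_Hamilton_complex:
  assumes "linear T" shows "T (T w) = ctrace T *\<^sub>R T w - cdet T *\<^sub>R w"
  apply (subst linear_complex_expand[OF assms, of "T w"])
  apply (subst (1 2 3) linear_complex_expand[OF assms, of w])
  by (simp add: complex_eq_iff ctrace_def cdet_def algebra_simps)

lemma cdet_funpow: "linear T \<Longrightarrow> cdet (T ^^ n) = cdet T ^ n"
  by (induction n) (auto simp: cdet_compose)

lemma cdet_eq_1:
  assumes "linear T" "T ^^ n = id" "n > 0" "cdet T > 0" shows "cdet T = 1"
  using assms cdet_funpow[of T n] 
  by (metis cdet_id less_eq_real_def power_eq_1_iff order.asym abs_of_pos real_norm_def)

text \<open>
  By the Cayley-Hamilton relation the traces \<open>t\<^sub>k\<close> of the powers satisfy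
  \<open>t\<^sub>k\<^sub>+\<^sub>2 = t\<^sub>1 t\<^sub>k\<^sub>+\<^sub>1 - t\<^sub>k\<close>; they would increase strictly from \<open>t\<^sub>0 = 2\<close> if \<open>t\<^sub>1 > 2\<close>, and never
  return to the trace of the identity.
\<close>

lemma ctrace_le_2:
  assumes "linear T" "cdet T = 1" "T ^^ n = id" "n > 0"
  shows "ctrace T \<le> 2"
proof (rule ccontr)
  assume "\<not> ?thesis" then have t: "ctrace T > 2" by simp
  have rec: "ctrace (T ^^ Suc (Suc k)) = ctrace T * ctrace (T ^^ Suc k) - ctrace (T ^^ k)" for k
  proof -
    have "ctrace (T ^^ Suc (Suc k)) = Re (T (T ((T ^^ k) 1))) + Im (T (T ((T ^^ k) \<i>)))"
      by (simp add: ctrace_def)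
    also have "\<dots> = ctrace T * (Re (T ((T ^^ k) 1)) + Im (T ((T ^^ k) \<i>)))
        - (Re ((T ^^ k) 1) + Im ((T ^^ k) \<i>))"
      unfolding Cayley_Hamilton_complex[OF assms(1)] assms(2) by (simp add: algebra_simps)
    finally show ?thesis by (simp add: ctrace_def)
  qed
  have "ctrace (T ^^ k) \<ge> 2 \<and> ctrace (T ^^ Suc k) > ctrace (T ^^ k)" for k
  proof (induction k)
    case 0 then show ?case using t by (simp add: ctrace_def)
  next
    case (Suc k)
    have "ctrace T * ctrace (T ^^ Suc k) \<ge> 2 * ctrace (T ^^ Suc k)"
      using Suc t by (intro mult_right_mono) (simp_all del: funpow.simps)
    then show ?case using Suc rec[of k] by (simp only: mult_2) linarith
  qed
  then have "ctrace (T ^^ n) > 2"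
    using assms(4) by (metis Suc_pred order_le_less_trans)
  then show False using assms(3) by (simp add: ctrace_def)
qed

text \<open>
  Such a map is unipotent, so its powers move each vector along an arithmetic progression.
\<close>

lemma ctrace_2_imp_id:
  assumes "linear T" "cdet T = 1" "T ^^ n = id" "n > 0" "ctrace T = 2"
  shows "T = id"
proof
  fix w
  have "(T ^^ k) w = w + k *\<^sub>R (T w - w)" for k
  proof (induction k rule: induct_nat_012)
    case (ge2 k)
    have "(T ^^ Suc (Suc k)) w = 2 *\<^sub>R (T ^^ Suc k) w - (T ^^ k) w"
      using Cayley_Hamilton_complex[OF assms(1), of "(T ^^ k) w"] assms(2,5) by simp
    also have "\<dots> = 2 *\<^sub>R (w + Suc k *\<^sub>R (T w - w)) - (w + k *\<^sub>R (T w - w))"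
      by (simp only: ge2)
    also have "\<dots> = w + Suc (Suc k) *\<^sub>R (T w - w)"
      by (simp add: complex_eq_iff algebra_simps)
    finally show ?case .
  qed auto
  from this[of n] show "T w = id w" using assms by simp
qed

text \<open>
  Trace \<open>-2\<close> is reduced to trace \<open>2\<close> by squaring.
\<close>

lemma elliptic_or_scalar:
  assumes "linear T" "cdet T = 1" "T ^^ n = id" "n > 0"
  shows "\<bar>ctrace T\<bar> < 2 \<or> T = id \<or> T = uminus"
proof -
  have lin2: "linear (T \<circ> T)" using assms(1) by (simp add: linear_compose)
  have d2: "cdet (T \<circ> T) = 1" using assms by (simp add: cdet_compose)
  have "(T \<circ> T) ^^ n = (T ^^ n) ^^ 2"
    using funpow_mult[where f=T and m=2 and n=n] funpow_mult[where f=T and m=n and n=2]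
    by (simp add: numeral_2_eq_2 mult.commute)
  then have p2: "(T \<circ> T) ^^ n = id" using assms(3) by (simp add: numeral_2_eq_2)
  have t2: "ctrace (T \<circ> T) = (ctrace T)\<^sup>2 - 2"
  proof -
    have "ctrace (T \<circ> T) = Re (T (T 1)) + Im (T (T \<i>))" by (simp add: ctrace_def)
    also have "\<dots> = ctrace T * (Re (T 1) + Im (T \<i>)) - 2"
      unfolding Cayley_Hamilton_complex[OF assms(1)] assms(2) by (simp add: algebra_simps)
    finally show ?thesis by (simp add: ctrace_def power2_eq_square)
  qed
  have "(ctrace T)\<^sup>2 \<le> 2\<^sup>2" using ctrace_le_2[OF lin2 d2 p2 assms(4)] t2 by simp
  then have "\<bar>ctrace T\<bar> \<le> 2" using abs_le_square_iff[of "ctrace T" 2] by simp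
  moreover have "T = uminus" if tr: "ctrace T = -2"
  proof
    fix w
    have "T \<circ> T = id" using ctrace_2_imp_id[OF lin2 d2 p2 assms(4)] t2 tr by simp
    then have "T (T w) = w" by (metis comp_apply id_apply)
    then have "w = -2 *\<^sub>R T w - w" using Cayley_Hamilton_complex[OF assms(1), of w] tr assms(2) by simp
    then show "T w = - w" by (auto simp: complex_eq_iff)
  qed
  moreover have "T = id" if "ctrace T = 2" using ctrace_2_imp_id assms that by blast
  ultimately show ?thesis by linarith
qed

text \<open>
  The determinant form on traceless 2 by 2 matrices has signature \<open>(1, 2)\<close>. The matrix with
  entries \<open>x, y, z, -x\<close> is elliptic, that is, has positive determinant, so the form is negative
  definite on its orthogonal complement (orthogonality is vanishing of the trace of the product).
\<close>

lemma orthogonal_to_elliptic: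
  fixes x y z p q r :: real
  assumes ell: "x\<^sup>2 + y * z < 0" and orth: "2 * x * p + y * r + z * q = 0" and "p\<^sup>2 + q * r \<le> 0"
  shows "p = 0 \<and> q = 0 \<and> r = 0"
proof -
  have A: "(2 * x * p)\<^sup>2 = (y * r + z * q)\<^sup>2"
    using orth by (metis add.assoc add_eq_0_iff power2_minus)
  have B: "x\<^sup>2 * p\<^sup>2 \<le> x\<^sup>2 * (- (q * r))" using assms(3) by (intro mult_left_mono) auto
  have qr: "0 \<le> - (q * r)" using assms(3) by (smt (verit) zero_le_power2)
  have yz: "y * z < 0" using ell by (smt (verit) zero_le_power2)
  have C: "4 * (x\<^sup>2 * p\<^sup>2) = (y * r - z * q)\<^sup>2 + 4 * ((y * z) * (q * r))"
    using A by (simp add: power2_eq_square algebra_simps)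
  have "4 * ((x\<^sup>2 + y * z) * (q * r)) \<le> 0"
    using B C by (smt (verit) distrib_right mult_minus_right zero_le_power2)
  moreover have "(x\<^sup>2 + y * z) * (q * r) \<ge> 0" using ell qr by (simp add: mult_nonpos_nonpos)
  ultimately have "(x\<^sup>2 + y * z) * (q * r) = 0" by linarith
  then have 0: "q * r = 0" using ell by auto
  then have "p = 0" using assms(3) by (metis add.right_neutral power2_less_eq_zero_iff)
  with orth have "y * r = - (z * q)" by simp
  with 0 yz \<open>p = 0\<close> show ?thesis by (metis mult_eq_0_iff mult_zero_left mult_zero_right neg_equal_0_iff_equal order_less_irrefl)
qed

text \<open>
  Elliptic elements of \<open>SL(2,\<real>)\<close> with different fixed points in the hyperbolic plane have a
  hyperbolic commutator, which has infinite order; hence finite order forces them to commute.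
  Algebraically: with \<open>K\<close> the commutator and \<open>C = ST - TS = (K - 1)TS\<close> one gets
  \<open>det C = 2 - tr K\<close>, which is nonnegative as \<open>K\<close> has finite order. But \<open>C\<close> is traceless and orthogonal
  to the traceless part of the elliptic map \<open>S\<close>, so its determinant can only be nonnegative if
  \<open>C = 0\<close>.
\<close>

lemma finite_order_commutator:
  assumes S: "linear S" "cdet S = 1" "S ^^ n = id" "n > 0"
    and T: "linear T" "cdet T = 1"
    and K: "linear K" "cdet K = 1" "K ^^ k = id" "k > 0"
    and KTS: "K \<circ> T \<circ> S = S \<circ> T"
  shows "S \<circ> T = T \<circ> S"
proof -
  let ?C = "\<lambda>w. S (T w) - T (S w)"
  let ?K = "\<lambda>w. K w - w"
  have lST: "linear (S \<circ> T)" "linear (T \<circ> S)" using S T by (simp_all add: linear_compose)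
  have lK: "linear ?K" using linear_compose_sub[OF K(1) linear_id] by simp
  have "?C = ?K \<circ> (T \<circ> S)" using KTS by (auto simp: fun_eq_iff)
  then have "cdet ?C = cdet ?K * (cdet T * cdet S)"
    using cdet_compose[OF lK] cdet_compose[OF T(1)] by metis
  also have "cdet ?K = 2 - ctrace K" using K(2) by (simp add: cdet_def ctrace_def algebra_simps)
  finally have det: "cdet ?C \<ge> 0" using S(2) T(2) ctrace_le_2[OF K] by simp
  show ?thesis
  proof (cases "\<bar>ctrace S\<bar> < 2")
    case False
    then have "S = id \<or> S = uminus" using elliptic_or_scalar[OF S] by blast
    then show ?thesis using T(1) by (auto simp: linear_neg fun_eq_iff)
  next
    case True
    define x y z where "x = (Re (S 1) - Im (S \<i>)) / 2" and "y = Re (S \<i>)" and "z = Im (S 1)"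
    define p q r where "p = Re (?C 1)" and "q = Re (?C \<i>)" and "r = Im (?C 1)"
    have s: "Im (?C \<i>) = - p" 
      unfolding p_def
      apply (subst linear_complex_expand[OF S(1), of "T 1"] linear_complex_expand[OF S(1), of "T \<i>"] )+
      apply (subst linear_complex_expand[OF T(1), of "S 1"] linear_complex_expand[OF T(1), of "S \<i>"] )+
      by (simp add: algebra_simps)
    have "(ctrace S)\<^sup>2 < 2\<^sup>2" using True by (metis abs_le_square_iff abs_numeral linorder_not_le)
    then have "x\<^sup>2 + y * z < 0" using S(2) unfolding x_def y_def z_def
      by (simp add: ctrace_def cdet_def power2_eq_square field_simps)
    moreover have "2 * x * p + y * r + z * q = 0" unfolding x_def y_def z_def p_def q_def r_def
      apply (subst linear_complex_expand[OF S(1), of "T 1"] linear_complex_expand[OF S(1), of "T \<i>"] )+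
      apply (subst linear_complex_expand[OF T(1), of "S 1"] linear_complex_expand[OF T(1), of "S \<i>"] )+
      by (simp add: field_simps)
    moreover have "p\<^sup>2 + q * r \<le> 0"
    proof -
      have "cdet ?C = p * Im (?C \<i>) - q * r" unfolding cdet_def p_def q_def r_def ..
      then show ?thesis using det s by (simp add: power2_eq_square)
    qed
    ultimately have "p = 0 \<and> q = 0 \<and> r = 0" by (rule orthogonal_to_elliptic)
    then have "?C 1 = 0" "?C \<i> = 0" using s unfolding p_def q_def r_def by (simp_all add: complex_eq_iff)
    then show ?thesis by (intro linear_complex_eqI lST) auto
  qed
qed

section \<open>Winding numbers and the sign of a single zero\<close>

text \<open>
  Moving \<open>Ln c\<close> linearly to \<open>0\<close> deforms the loop into the unit circle.
\<close>

lemma winding_number_rotating: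
  assumes "c \<noteq> 0"
  shows "winding_number (\<lambda>t. c * exp (of_real (2 * pi * t) * \<i>)) 0 = 1"
proof -
  define l where "l = Ln c"
  have c: "c = exp l" using assms by (simp add: l_def)
  let ?h = "\<lambda>z. exp (of_real (1 - fst z) * l) * exp (of_real (2 * pi * snd z) * \<i>)"
  have "homotopic_loops (- {0}) (\<lambda>t. c * exp (of_real (2 * pi * t) * \<i>)) (circlepath 0 1)"
    unfolding homotopic_loops
  proof (intro exI conjI)
    show "continuous_on ({0..1} \<times> {0..1}) ?h" by (intro continuous_intros)
  qed (auto simp: c circlepath_def part_circlepath_def linepath_def pathstart_def pathfinish_def mult_ac exp_two_pi_i)
  then show ?thesis
    using winding_number_homotopic_loops winding_number_circlepath[of 0 0 1] by simp
qed

lemma winding_number_rotating_back: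
  assumes "c \<noteq> 0"
  shows "winding_number (\<lambda>t. c * exp (- (of_real (2 * pi * t) * \<i>))) 0 = - 1"
proof -
  let ?p = "\<lambda>t. c * exp (of_real (2 * pi * t) * \<i>)"
  have "winding_number (reversepath ?p) 0 = - winding_number ?p 0"
    by (rule winding_number_reversepath)
       (auto simp: path_def path_image_def assms intro!: continuous_intros)
  moreover have "reversepath ?p = (\<lambda>t. c * exp (- (of_real (2 * pi * t) * \<i>)))"
    by (auto simp: reversepath_def fun_eq_iff algebra_simps exp_diff exp_minus exp_two_pi_i exp_two_pi_i' field_simps)
  ultimately show ?thesis using winding_number_rotating[OF assms] by metis
qed

text \<open>
  In this form the determinant is \<open>\<bar>\<alpha>\<bar>\<^sup>2 - \<bar>\<beta>\<bar>\<^sup>2\<close>.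
\<close>

lemma linear_complex_conj_form:
  assumes "linear L" "cdet L < 0"
  obtains \<alpha> \<beta> where "\<And>w. L w = \<alpha> * w + \<beta> * cnj w" "norm \<alpha> < norm \<beta>"
proof
  define \<alpha> where "\<alpha> = (L 1 - \<i> * L \<i>) / 2"
  define \<beta> where "\<beta> = (L 1 + \<i> * L \<i>) / 2"
  show "L w = \<alpha> * w + \<beta> * cnj w" for w
    by (subst linear_complex_expand[OF assms(1), of w])
       (simp add: complex_eq_iff \<alpha>_def \<beta>_def field_simps)
  have "(norm \<alpha>)\<^sup>2 - (norm \<beta>)\<^sup>2 = cdet L"
    unfolding cmod_power2 by (simp add: \<alpha>_def \<beta>_def cdet_def field_simps power2_eq_square)
  then have "(norm \<alpha>)\<^sup>2 < (norm \<beta>)\<^sup>2" using assms(2) by linarith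
  then show "norm \<alpha> < norm \<beta>" by (rule power2_less_imp_less) (rule norm_ge_zero)
qed

text \<open>
  All circles around the only zero \<open>b\<close> are mapped to homotopic loops in the punctured plane. The far
  field condition gives large circles winding number \<open>1\<close>, whereas small circles have winding number
  \<open>-1\<close>, because \<open>L\<close> reverses orientation.
\<close>

lemma no_orientation_reversing_single_zero:
  fixes G :: "complex \<Rightarrow> complex"
  assumes cont: "continuous_on UNIV G"
    and nz: "\<And>z. z \<noteq> b \<Longrightarrow> G z \<noteq> 0" and b: "G b = 0"
    and der: "(G has_derivative L) (at b)" and neg: "cdet L < 0"
    and far: "\<And>z. norm z > R \<Longrightarrow> Re (cnj z * G z) < 0"
  shows False
proof -
  let ?e = "\<lambda>t::real. exp (of_real (2 * pi * t) * \<i>)"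
  let ?\<gamma> = "\<lambda>r t. G (b + of_real r * ?e t)"
  have cG: "continuous_on S (\<lambda>x. G (f x))" if "continuous_on S f" for S and f :: "'x::topological_space \<Rightarrow> complex"
    using continuous_on_compose2[OF cont that] by simp
  have path: "path (?\<gamma> r)" for r unfolding path_def by (intro cG continuous_intros)
  have loop: "pathfinish (?\<gamma> r) = pathstart (?\<gamma> r)" for r
    by (simp add: pathfinish_def pathstart_def mult_ac exp_two_pi_i)
  have same: "winding_number (?\<gamma> r) 0 = winding_number (?\<gamma> s) 0" if rs: "0 < r" "0 < s" for r s
  proof (rule winding_number_homotopic_loops)
    let ?\<rho> = "\<lambda>u::real. (1 - u) * r + u * s"
    have pos: "?\<rho> u > 0" if "u \<in> {0..1}" for u
      using that rs by (cases "u = 0") (simp_all add: add_nonneg_pos)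
    show "homotopic_loops (- {0}) (?\<gamma> r) (?\<gamma> s)"
      unfolding homotopic_loops
    proof (intro exI conjI)
      let ?h = "\<lambda>z. G (b + of_real (?\<rho> (fst z)) * ?e (snd z))"
      show "continuous_on ({0..1} \<times> {0..1}) ?h" by (intro cG continuous_intros)
      show "?h \<in> {0..1} \<times> {0..1} \<rightarrow> - {0}"
      proof
        fix z :: "real \<times> real" assume z: "z \<in> {0..1} \<times> {0..1}"
        have "?\<rho> (fst z) \<noteq> 0" using pos[of "fst z"] z by (auto simp: mem_Times_iff)
        then have "of_real (?\<rho> (fst z)) * ?e (snd z) \<noteq> 0" by (simp only: mult_eq_0_iff of_real_eq_0_iff exp_not_eq_zero simp_thms)
        then show "?h z \<in> - {0}" by (simp only: nz Compl_iff singleton_iff add_cancel_left_right simp_thms not_False_eq_True)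
      qed
    qed (auto simp: pathfinish_def pathstart_def mult_ac exp_two_pi_i)
  qed
  \<comment> \<open>At each point \<open>z\<close> of a large circle the values \<open>G z\<close> and \<open>b - z\<close> lie in a common open half plane,
    so \<open>G\<close> winds like \<open>b - z\<close>, once. The radius is large enough to exceed both \<open>R\<close> and \<open>norm b\<close>
    after the shift of the centre by \<open>b\<close>.\<close>
  define r where "r = 1 + \<bar>R\<bar> + 2 * norm b"
  have r0: "r > 0" by (auto simp: r_def intro: add_pos_nonneg)
  have "winding_number (\<lambda>t. of_real (- r) * ?e t) 0 = winding_number (?\<gamma> r) 0"
  proof (rule winding_number_loops_linear_eq[OF path _ loop])
    show "path (\<lambda>t. of_real (- r) * ?e t)" unfolding path_def by (intro continuous_intros)
    show "pathfinish (\<lambda>t. of_real (- r) * ?e t) = pathstart (\<lambda>t. of_real (- r) * ?e t)"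
      by (simp add: pathfinish_def pathstart_def mult_ac exp_two_pi_i)
    fix t :: real
    define w z where "w = of_real r * ?e t" and "z = b + w"
    have nw: "norm w = r" using r0 by (simp add: w_def norm_mult)
    have w: "of_real (- r) * ?e t = b - z" by (simp add: z_def w_def)
    have "norm w \<le> norm z + norm b" using norm_triangle_ineq4[of z b] by (simp add: z_def)
    then have z: "norm z > R" "norm z > norm b"
      unfolding nw r_def using norm_ge_zero[of b] by linarith+
    have "Re (cnj z * (b - z)) = Re (cnj z * b) - (norm z)\<^sup>2"
      using cmod_power2[of z] by (simp add: power2_eq_square algebra_simps)
    moreover have "Re (cnj z * b) \<le> norm z * norm b"
      using complex_Re_le_cmod[of "cnj z * b"] by (simp only: norm_mult complex_mod_cnj)
    moreover have "norm z * norm b < (norm z)\<^sup>2"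
      unfolding power2_eq_square using z(2)
      by (intro mult_strict_left_mono le_less_trans[OF norm_ge_zero z(2)])
    ultimately have 1: "Re (cnj z * (b - z)) < 0" by linarith
    have 2: "Re (cnj z * G z) < 0" by (rule far[OF z(1)])
    have "convex {y. Re (cnj z * y) < 0}"
      using convex_halfspace_lt[of z 0] by (simp add: inner_complex_def)
    then have "closed_segment (G z) (b - z) \<subseteq> {y. Re (cnj z * y) < 0}"
      using 1 2 by (intro closed_segment_subset) auto
    then have "0 \<notin> closed_segment (G z) (b - z)" by auto
    then show "0 \<notin> closed_segment (?\<gamma> r t) (of_real (- r) * ?e t)"
      unfolding w unfolding z_def w_def .
  qed
  then have one: "winding_number (?\<gamma> r) 0 = 1"
    using winding_number_rotating[of "of_real (- r)"] r0 by simp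
  \<comment> \<open>On a small circle the term \<open>\<beta> * cnj w\<close> dominates both \<open>\<alpha> * w\<close> and the error of the linear
    approximation, so there \<open>G\<close> winds like \<open>cnj w\<close>, minus once.\<close>
  have linL: "linear L" using der has_derivative_linear by blast
  obtain \<alpha> \<beta> where L: "\<And>w. L w = \<alpha> * w + \<beta> * cnj w" and ab: "norm \<alpha> < norm \<beta>"
    using linear_complex_conj_form[OF linL neg] by blast
  obtain d where d: "d > 0" "\<And>y. norm (y - b) < d \<Longrightarrow>
      norm (G y - G b - L (y - b)) \<le> (norm \<beta> - norm \<alpha>) / 2 * norm (y - b)"
    using der ab unfolding has_derivative_at_alt by (metis diff_gt_0_iff_gt half_gt_zero)
  define s where "s = d / 2"
  have s0: "s > 0" "s < d" using d by (auto simp: s_def)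
  have "winding_number (\<lambda>t. (\<beta> * of_real s) * exp (- (of_real (2 * pi * t) * \<i>))) 0 = winding_number (?\<gamma> s) 0"
    (is "winding_number ?q 0 = _")
  proof (rule winding_number_loops_linear_eq[OF path _ loop])
    show "path ?q" unfolding path_def by (intro continuous_intros)
    show "pathfinish ?q = pathstart ?q"
      by (simp add: pathfinish_def pathstart_def mult_ac exp_two_pi_i exp_minus)
    fix t :: real
    define w where "w = of_real s * ?e t"
    have nw: "norm w = s" using s0 by (simp add: w_def norm_mult)
    have q: "?q t = \<beta> * cnj w" by (simp add: w_def exp_cnj mult_ac)
    have "norm (G (b + w) - L w) \<le> (norm \<beta> - norm \<alpha>) / 2 * s"
      using d(2)[of "b + w"] nw s0 b by simp
    moreover have "norm (L w - \<beta> * cnj w) = norm \<alpha> * s" unfolding L using nw by (simp add: norm_mult)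
    ultimately have "norm (G (b + w) - \<beta> * cnj w) \<le> (norm \<beta> - norm \<alpha>) / 2 * s + norm \<alpha> * s"
      using norm_triangle_ineq[of "G (b + w) - L w" "L w - \<beta> * cnj w"] by simp
    also have "\<dots> < norm \<beta> * s" using ab s0 by (simp add: field_simps)
    also have "\<dots> = norm (\<beta> * cnj w)" using nw by (simp only: norm_mult complex_mod_cnj)
    finally have close: "norm (\<beta> * cnj w - G (b + w)) < norm (\<beta> * cnj w)"
      by (simp only: norm_minus_commute)
    then have "\<beta> * cnj w \<in> ball (\<beta> * cnj w) (norm (\<beta> * cnj w))"
      using norm_ge_zero[of "\<beta> * cnj w - G (b + w)"] by (simp only: centre_in_ball)
    with close have "closed_segment (G (b + w)) (\<beta> * cnj w) \<subseteq> ball (\<beta> * cnj w) (norm (\<beta> * cnj w))"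
      by (intro closed_segment_subset) (simp_all only: convex_ball mem_ball dist_norm)
    then have "0 \<notin> closed_segment (G (b + w)) (\<beta> * cnj w)" by auto
    then show "0 \<notin> closed_segment (?\<gamma> s t) (?q t)" unfolding q unfolding w_def .
  qed
  moreover have "\<beta> * of_real s \<noteq> 0" using ab s0 norm_ge_zero[of \<alpha>] by auto
  ultimately have "winding_number (?\<gamma> s) 0 = - 1"
    using winding_number_rotating_back by metis
  with one same[OF r0 s0(1)] show False by simp
qed

section \<open>Maps of class \<open>C\<^sup>1\<close> and finite order\<close>

lemma C1_onI:
  assumes "open S" "\<And>x. x \<in> S \<Longrightarrow> (f has_derivative blinfun_apply (F' x)) (at x)" "continuous_on S F'"
  shows "C1_on S f"
  unfolding C1_on_def using assms by blast

lemma C1_onE: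
  assumes "C1_on S f" "x \<in> S"
  obtains U F F' where "open U" "x \<in> U" "\<forall>y\<in>U \<inter> S. F y = f y"
    "\<forall>y\<in>U. (F has_derivative blinfun_apply (F' y)) (at y)" "continuous_on U F'"
proof -
  from bspec[OF assms(1)[unfolded C1_on_def] assms(2)] obtain U F F' where
    "open U" "x \<in> U" "\<forall>y\<in>U \<inter> S. F y = f y"
    "\<forall>y\<in>U. (F has_derivative blinfun_apply (F' y)) (at y)" "continuous_on U F'"
    by (elim exE conjE)
  then show thesis by (rule that)
qed

lemma C1_on_open_derivative:
  assumes "C1_on S f" "open S" "x \<in> S"
  obtains U F' where "open U" "x \<in> U" "U \<subseteq> S" 
    "\<forall>y\<in>U. (f has_derivative blinfun_apply (F' y)) (at y)" "continuous_on U F'"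
proof -
  obtain U F F' where U: "open U" "x \<in> U" "\<forall>y\<in>U \<inter> S. F y = f y"
    "\<forall>y\<in>U. (F has_derivative blinfun_apply (F' y)) (at y)" "continuous_on U F'"
    by (rule C1_onE[OF assms(1,3)])
  have "(f has_derivative blinfun_apply (F' y)) (at y)" if "y \<in> U \<inter> S" for y
    by (rule has_derivative_transform_within_open[of F _ _ _ "U \<inter> S"]) (use U assms that in auto)
  then show ?thesis
    by (intro that[of "U \<inter> S" F']) (use U assms in \<open>auto intro: continuous_on_subset\<close>)
qed

lemma C1_on_obtains_derivative:
  assumes "C1_on S f" "open S" "x \<in> S"
  obtains D where "(f has_derivative D) (at x)"
proof -
  obtain U F' where "open U" "x \<in> U" "U \<subseteq> S" 
    "\<forall>y\<in>U. (f has_derivative blinfun_apply (F' y)) (at y)" "continuous_on U F'"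
    by (rule C1_on_open_derivative[OF assms])
  then show ?thesis using that by blast
qed

lemma C1_on_const: "C1_on S (\<lambda>x. c)"
  unfolding C1_on_def
  by (intro ballI exI[of _ UNIV] exI[of _ "\<lambda>x. c"] exI[of _ "\<lambda>_. 0"]) (auto simp: zero_blinfun.rep_eq)

lemma C1_on_add:
  assumes "C1_on S f" "C1_on S g"
  shows "C1_on S (\<lambda>x. f x + g x)"
  unfolding C1_on_def
proof
  fix x assume x: "x \<in> S"
  obtain U F F' where U: "open U" "x \<in> U" "\<forall>y\<in>U \<inter> S. F y = f y"
    "\<forall>y\<in>U. (F has_derivative blinfun_apply (F' y)) (at y)" "continuous_on U F'"
    by (rule C1_onE[OF assms(1) x])
  obtain V G G' where V: "open V" "x \<in> V" "\<forall>y\<in>V \<inter> S. G y = g y"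
    "\<forall>y\<in>V. (G has_derivative blinfun_apply (G' y)) (at y)" "continuous_on V G'"
    by (rule C1_onE[OF assms(2) x])
  have "continuous_on (U \<inter> V) (\<lambda>y. F' y + G' y)"
    by (intro continuous_intros) (auto intro: continuous_on_subset U(5) V(5))
  moreover have "((\<lambda>y. F y + G y) has_derivative blinfun_apply (F' y + G' y)) (at y)" if "y \<in> U \<inter> V" for y
    using has_derivative_add[of F "F' y" "at y" G "G' y"] U(4) V(4) that by (simp add: plus_blinfun.rep_eq)
  ultimately show "\<exists>U H H'. open U \<and> x \<in> U \<and> (\<forall>y\<in>U \<inter> S. H y = f y + g y) \<and>
        (\<forall>y\<in>U. (H has_derivative blinfun_apply (H' y)) (at y)) \<and> continuous_on U H'"
    using U V by (intro exI[of _ "U \<inter> V"] exI[of _ "\<lambda>y. F y + G y"] exI[of _ "\<lambda>y. F' y + G' y"]) auto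
qed

lemma C1_on_scaleR:
  fixes r :: "'a::euclidean_space \<Rightarrow> real" and f :: "'a \<Rightarrow> 'b::euclidean_space"
  assumes "C1_on S r" "C1_on S f"
  shows "C1_on S (\<lambda>x. r x *\<^sub>R f x)"
  unfolding C1_on_def
proof
  fix x assume x: "x \<in> S"
  obtain U F F' where U: "open U" "x \<in> U" "\<forall>y\<in>U \<inter> S. F y = r y"
    "\<forall>y\<in>U. (F has_derivative blinfun_apply (F' y)) (at y)" "continuous_on U F'"
    by (rule C1_onE[OF assms(1) x])
  obtain V G G' where V: "open V" "x \<in> V" "\<forall>y\<in>V \<inter> S. G y = f y"
    "\<forall>y\<in>V. (G has_derivative blinfun_apply (G' y)) (at y)" "continuous_on V G'"
    by (rule C1_onE[OF assms(2) x])
  let ?H = "\<lambda>y. F y *\<^sub>R G' y + (blinfun_scaleR_left (G y) o\<^sub>L F' y)"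
  have c: "continuous_on U F" "continuous_on V G"
    using U(4) V(4) by (meson differentiableI differentiable_at_imp_differentiable_on
        differentiable_imp_continuous_on)+
  have "continuous_on (U \<inter> V) ?H"
    by (intro continuous_intros) (auto intro: continuous_on_subset U(5) V(5) c)
  moreover have "((\<lambda>y. F y *\<^sub>R G y) has_derivative blinfun_apply (?H y)) (at y)" if "y \<in> U \<inter> V" for y
    using has_derivative_scaleR[of F "F' y" y UNIV G "G' y"] U(4) V(4) that
    by (simp add: plus_blinfun.rep_eq scaleR_blinfun.rep_eq)
  ultimately show "\<exists>U H H'. open U \<and> x \<in> U \<and> (\<forall>y\<in>U \<inter> S. H y = r y *\<^sub>R f y) \<and>
        (\<forall>y\<in>U. (H has_derivative blinfun_apply (H' y)) (at y)) \<and> continuous_on U H'"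
    using U V by (intro exI[of _ "U \<inter> V"] exI[of _ "\<lambda>y. F y *\<^sub>R G y"] exI[of _ ?H]) auto
qed

lemma C1_on_sum:
  "(\<And>i. i \<in> I \<Longrightarrow> C1_on S (f i)) \<Longrightarrow> C1_on S (\<lambda>x. \<Sum>i\<in>I. f i x)"
  by (induction I rule: infinite_finite_induct) (auto simp: C1_on_const C1_on_add)

lemma C1_on_norm: "C1_on (- {0::'a::euclidean_space}) norm"
proof (rule C1_onI)
  show "(norm has_derivative blinfun_apply (blinfun_inner_left (sgn x))) (at x)" if "x \<in> - {0}" for x :: 'a
    using has_derivative_norm[of x] that by (simp add: inner_commute)
  show "continuous_on (- {0}) (\<lambda>x::'a. blinfun_inner_left (sgn x))"
    by (intro continuous_intros) (auto simp: sgn_div_norm[abs_def] intro!: continuous_intros)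
qed auto

lemma C1_on_inverse: "C1_on (- {0::real}) inverse"
proof (rule C1_onI)
  show "(inverse has_derivative blinfun_apply (blinfun_scaleR_left (- (inverse x * inverse x)))) (at x)"
    if "x \<in> - {0}" for x :: real
    using has_derivative_inverse'[of x UNIV] that by (simp add: mult_ac)
  show "continuous_on (- {0}) (\<lambda>x::real. blinfun_scaleR_left (- (inverse x * inverse x)))"
    by (intro continuous_intros) auto
qed auto

lemma C1_on_funpow:
  assumes "C1_on S f" "f ` S \<subseteq> S" shows "C1_on S (f ^^ n)"
proof (induction n)
  case 0 show ?case using C1_on_id by (simp add: id_def)
next
  case (Suc n)
  have "(f ^^ n) ` S \<subseteq> S" using assms(2) by (induction n) auto
  then show ?case using C1_on_compose[OF Suc assms(1)] by (simp add: o_def)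
qed

text \<open>
  The locally injective half of the inverse function theorem, for a derivative that is injective but
  need not be onto.
\<close>

lemma C1_on_locally_injective:
  fixes f :: "'a::euclidean_space \<Rightarrow> 'b::euclidean_space"
  assumes "C1_on S f" "open S" "x \<in> S" and D: "(f has_derivative D) (at x)" "inj D"
  obtains r where "r > 0" "inj_on f (ball x r)"
proof -
  obtain U F' where U: "open U" "x \<in> U" "U \<subseteq> S" 
    "\<forall>y\<in>U. (f has_derivative blinfun_apply (F' y)) (at y)" "continuous_on U F'"
    by (rule C1_on_open_derivative[OF assms(1-3)])
  have F'x: "blinfun_apply (F' x) = D"
    by (rule has_derivative_unique[OF bspec[OF U(4,2)] D(1)])
  have "linear D" using D(1) by (rule has_derivative_linear)
  from linear_injective_left_inverse[OF this D(2)]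
  obtain g where g: "linear g" "g \<circ> D = id" by blast
  have lim: "\<exists>d>0. \<forall>y. dist x y < d \<longrightarrow> onorm (\<lambda>v. F' y v - F' x v) < e" if "e > 0" for e
  proof -
    have "isCont F' x" using U(1,2,5) by (simp add: continuous_on_eq_continuous_at)
    then have "\<exists>d>0. \<forall>y. dist y x < d \<longrightarrow> dist (F' y) (F' x) < e"
      using that unfolding continuous_at_eps_delta by (elim allE impE)
    moreover have "onorm (\<lambda>v. F' y v - F' x v) = dist (F' y) (F' x)" for y
      by (simp add: dist_norm norm_blinfun.rep_eq minus_blinfun.rep_eq)
    ultimately show ?thesis by (simp only: dist_commute)
  qed
  show ?thesis
  proof (rule has_derivative_locally_injective[where a = x and S = U and g' = g
        and f' = "\<lambda>y. blinfun_apply (F' y)" and f = f])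
    show "bounded_linear g" using g(1) by (simp only: linear_conv_bounded_linear)
    show "g \<circ> blinfun_apply (F' x) = id" unfolding F'x by (rule g(2))
    show "(f has_derivative blinfun_apply (F' y)) (at y)" if "y \<in> U" for y
      using bspec[OF U(4) that] .
    show "r > 0 \<Longrightarrow> ball x r \<subseteq> U \<Longrightarrow> inj_on f (ball x r) \<Longrightarrow> thesis" for r
      by (rule that)
  qed (fact U lim)+
qed

text \<open>
  The sum \<open>F\<close> of the iterates \<open>h\<^sup>i\<close> with \<open>i < n\<close> satisfies \<open>F \<circ> h = F\<close>, and its derivative at \<open>x\<close> is
  \<open>n\<close> times the identity. Hence \<open>F\<close> is injective near \<open>x\<close>, and there \<open>F (h y) = F y\<close> gives
  \<open>h y = y\<close>.
\<close>

lemma finite_order_C1_tangent_to_id: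
  fixes h :: "'a::euclidean_space \<Rightarrow> 'a"
  assumes S: "open S" "x \<in> S" "h ` S \<subseteq> S" and C1: "C1_on S h"
    and n: "n > 0" "\<And>y. y \<in> S \<Longrightarrow> (h ^^ n) y = y"
    and x: "h x = x" and D: "(h has_derivative id) (at x)"
  shows "\<exists>e>0. \<forall>y\<in>ball x e. h y = y"
proof -
  define F where "F y = (\<Sum>i<n. (h ^^ i) y)" for y
  have "C1_on S F" unfolding F_def by (intro C1_on_sum C1_on_funpow C1 S)
  have "((h ^^ i) has_derivative id) (at x)" for i
  proof (induction i)
    case 0 show ?case by (simp add: id_def)
  next
    case (Suc i)
    have "(h ^^ i) x = x" by (induction i) (auto simp: x)
    then show ?case using diff_chain_at[OF Suc, of h id] D by (simp add: o_def id_def)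
  qed
  then have "(F has_derivative (\<lambda>v. \<Sum>i<n. id v)) (at x)"
    unfolding F_def by (intro has_derivative_sum)
  then have "(F has_derivative (\<lambda>v. real n *\<^sub>R v)) (at x)" by (simp add: sum_constant_scaleR)
  moreover have "inj (\<lambda>v::'a. real n *\<^sub>R v)" using n by (auto simp: inj_def)
  ultimately obtain r where r: "r > 0" "inj_on F (ball x r)"
    using C1_on_locally_injective[OF \<open>C1_on S F\<close> S(1,2)] by metis
  have "isCont h x" using D has_derivative_continuous by blast
  then obtain d where d: "d > 0" "\<And>y. dist y x < d \<Longrightarrow> dist (h y) x < r"
    using r(1) x by (auto simp: continuous_at_eps_delta)
  obtain e where e: "e > 0" "ball x e \<subseteq> S" using S by (meson openE)
  have "h y = y" if y: "y \<in> ball x (min r (min d e))" for y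
  proof -
    have yS: "y \<in> S" using y e by auto
    have "F (h y) = (\<Sum>i<n. (h ^^ Suc i) y)" unfolding F_def by (simp add: funpow_swap1)
    also have "\<dots> = F y + (h ^^ n) y - (h ^^ 0) y"
      unfolding F_def using sum.lessThan_Suc_shift[of "\<lambda>i. (h ^^ i) y" n] by simp
    also have "\<dots> = F y" using n(2)[OF yS] by simp
    finally show ?thesis
      using r(2) y d(2)[of y] by (auto simp: inj_on_def dist_commute)
  qed
  then show ?thesis using r d e by (intro exI[of _ "min r (min d e)"]) auto
qed

section \<open>Homogeneous extensions and their tangent action\<close>

text \<open>
  A diffeomorphism \<open>f\<close> of the sphere is studied through the map \<open>y \<mapsto> \<bar>y\<bar> f (y / \<bar>y\<bar>)\<close> of the whole space.
  This makes derivatives genuine and unique linear maps of the ambient space, and preservation of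
  orientation becomes positivity of the determinant. Such maps have the following properties.
\<close>

definition conical :: "(real^3 \<Rightarrow> real^3) \<Rightarrow> bool" where
  "conical h \<longleftrightarrow> (\<forall>y. norm (h y) = norm y) \<and> (\<forall>t\<ge>0. \<forall>y. h (t *\<^sub>R y) = t *\<^sub>R h y) \<and>
     C1_on (- {0}) h \<and> (\<forall>y D. y \<noteq> 0 \<longrightarrow> (h has_derivative D) (at y) \<longrightarrow> det (matrix D) > 0)"

lemma conicalD:
  assumes "conical h"
  shows "norm (h y) = norm y" "t \<ge> 0 \<Longrightarrow> h (t *\<^sub>R y) = t *\<^sub>R h y" "C1_on (- {0}) h"
    "y \<noteq> 0 \<Longrightarrow> (h has_derivative D) (at y) \<Longrightarrow> det (matrix D) > 0"
  using assms unfolding conical_def by auto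

lemma conical_derivative:
  assumes "conical h" "y \<noteq> 0" obtains D where "(h has_derivative D) (at y)"
  using C1_on_obtains_derivative[OF conicalD(3)[OF assms(1)], of y] assms(2) by auto

text \<open>
  Differentiating \<open>norm (h y)\<^sup>2 = norm y\<^sup>2\<close>; at a fixed point it says that the tangent plane of the
  sphere is preserved.
\<close>

lemma conical_derivative_inner:
  assumes h: "conical h" and D: "(h has_derivative D) (at y)"
  shows "D u \<bullet> h y = u \<bullet> y"
proof -
  have "((\<lambda>z. h z \<bullet> h z) has_derivative (\<lambda>u. h y \<bullet> D u + D u \<bullet> h y)) (at y)"
    by (intro has_derivative_inner D)
  also have "(\<lambda>z. h z \<bullet> h z) = (\<lambda>z. z \<bullet> z)"
    using conicalD(1)[OF h] by (simp add: dot_square_norm)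
  finally have "((\<lambda>z. z \<bullet> z) has_derivative (\<lambda>u. h y \<bullet> D u + D u \<bullet> h y)) (at y)" .
  moreover have "((\<lambda>z. z \<bullet> z) has_derivative (\<lambda>u. y \<bullet> u + u \<bullet> y)) (at y)"
    by (intro has_derivative_inner has_derivative_ident)
  ultimately have "(\<lambda>u. h y \<bullet> D u + D u \<bullet> h y) = (\<lambda>u. y \<bullet> u + u \<bullet> y)"
    by (rule has_derivative_unique)
  then have "h y \<bullet> D u + D u \<bullet> h y = y \<bullet> u + u \<bullet> y" by meson
  then show ?thesis by (simp add: inner_commute)
qed

text \<open>
  Euler's relation for functions that are homogeneous of degree one.
\<close>

lemma conical_derivative_radial:
  assumes h: "conical h" and D: "(h has_derivative D) (at x)"
  shows "D x = h x"
proof -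
  have "((\<lambda>t. h (t *\<^sub>R x)) has_derivative (\<lambda>s. D (s *\<^sub>R x))) (at (1::real))"
    using has_derivative_compose[of "\<lambda>t::real. t *\<^sub>R x" "\<lambda>s. s *\<^sub>R x" 1 UNIV h D] D
    by (simp add: has_derivative_scaleR_left)
  then have "((\<lambda>t. t *\<^sub>R h x) has_derivative (\<lambda>s. D (s *\<^sub>R x))) (at (1::real))"
    by (rule has_derivative_transform_within_open[of _ _ _ _ "{0<..}"])
       (auto simp: conicalD(2)[OF h])
  moreover have "((\<lambda>t. t *\<^sub>R h x) has_derivative (\<lambda>s. s *\<^sub>R h x)) (at (1::real))"
    by (intro has_derivative_scaleR_left has_derivative_ident)
  ultimately have "(\<lambda>s::real. D (s *\<^sub>R x)) = (\<lambda>s. s *\<^sub>R h x)" by (rule has_derivative_unique)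
  then have "D (1 *\<^sub>R x) = 1 *\<^sub>R h x" by meson
  then show ?thesis by simp
qed

lemma conical_nonzero: "conical h \<Longrightarrow> y \<noteq> 0 \<Longrightarrow> h y \<noteq> 0"
  using conicalD(1)[of h y] by auto

lemma conical_continuous: "conical h \<Longrightarrow> y \<noteq> 0 \<Longrightarrow> isCont h y"
  by (metis conical_derivative has_derivative_continuous)

lemma cdet_nonzero_inj:
  assumes "linear L" "cdet L \<noteq> 0" "L w = 0" shows "w = 0"
proof -
  have "Re w * Re (L 1) + Im w * Re (L \<i>) = 0" "Re w * Im (L 1) + Im w * Im (L \<i>) = 0"
    using linear_complex_expand[OF assms(1), of w] assms(3) by (simp_all add: complex_eq_iff)
  then have "Re w * cdet L = 0" "Im w * cdet L = 0" unfolding cdet_def by algebra+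
  then show ?thesis using assms(2) by (simp add: complex_eq_iff)
qed

text \<open>
  Complex coordinates \<open>\<pi>\<close> on the tangent plane of the sphere at \<open>x\<close>, with inverse \<open>J\<close>. The linear maps in the
  last assumption split into the identity of the axis through \<open>x\<close> and a map of the tangent plane.
\<close>

locale tangent_frame =
  fixes x :: "real^3" and J :: "complex \<Rightarrow> real^3" and \<pi> :: "real^3 \<Rightarrow> complex"
  assumes norm_x: "norm x = 1"
    and linear_J: "linear J" and linear_\<pi>: "linear \<pi>"
    and J_orthogonal: "J w \<bullet> x = 0" and \<pi>_J: "\<pi> (J w) = w"
    and split: "y = (x \<bullet> y) *\<^sub>R x + J (\<pi> y)"
    and cdet_conj: "linear D \<Longrightarrow> D x = x \<Longrightarrow> (\<And>v. D v \<bullet> x = v \<bullet> x) \<Longrightarrow> cdet (\<pi> \<circ> D \<circ> J) = det (matrix D)"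

text \<open>
  A rotation \<open>R\<close> that takes the third coordinate axis to \<open>x\<close> carries the first two axes to an
  orthonormal basis of the tangent plane.
\<close>

lemma tangent_frame_exists:
  assumes "norm x = 1" shows "\<exists>J \<pi>. tangent_frame x J \<pi>"
proof -
  let ?e = "\<lambda>i::3. axis i (1::real)"
  obtain R where R: "orthogonal_transformation R" "R (?e 3) = x"
    using rotation_exists_1[of "?e 3" x] assms by auto
  have linR: "linear R" using R by (simp add: orthogonal_transformation)
  define R' where "R' = inv_into UNIV R"
  have RR': "R (R' y) = y" "R' (R y) = y" for y
    using R(1) orthogonal_transformation_bij unfolding R'_def
    by (metis bij_inv_eq_iff)+
  have R': "orthogonal_transformation R'" unfolding R'_def using R(1) by (rule orthogonal_transformation_inv)
  have linR': "linear R'" using R' by (simp add: orthogonal_transformation)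
  have innerR: "R a \<bullet> R b = a \<bullet> b" for a b using R(1) by (simp add: orthogonal_transformation_def)
  have R'x: "R' x = ?e 3" using RR'(2)[of "?e 3"] R(2) by simp
  define J where "J w = R (Re w *\<^sub>R ?e 1 + Im w *\<^sub>R ?e 2)" for w
  define \<pi> where "\<pi> y = Complex (R' y $ 1) (R' y $ 2)" for y
  have "tangent_frame x J \<pi>"
  proof (rule tangent_frame.intro)
    show "norm x = 1" by (fact assms)
    show "linear J" unfolding J_def
      by (rule linearI) (simp_all add: linear_add[OF linR] linear_scale[OF linR] algebra_simps)
    show "linear \<pi>" unfolding \<pi>_def
      by (rule linearI) (simp_all add: linear_add[OF linR'] linear_scale[OF linR'] complex_eq_iff)
    show "J w \<bullet> x = 0" for w
      unfolding J_def R(2)[symmetric] innerR by (simp add: inner_add_left inner_axis_axis)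
    show "\<pi> (J w) = w" for w
      unfolding J_def \<pi>_def RR' by (simp add: axis_def complex_eq_iff)
    show "y = (x \<bullet> y) *\<^sub>R x + J (\<pi> y)" for y
    proof -
      have "x \<bullet> y = R' y $ 3" using innerR[of "?e 3" "R' y"] R(2) RR' by (simp add: inner_axis inner_commute)
      then have "R' ((x \<bullet> y) *\<^sub>R x + J (\<pi> y)) = R' y"
        unfolding J_def \<pi>_def
        by (simp add: linear_add[OF linR'] linear_scale[OF linR'] RR' R'x vec_eq_iff forall_3 axis_def)
      then show ?thesis by (metis RR'(1))
    qed
    fix D assume D: "linear D" "D x = x" "\<And>v. D v \<bullet> x = v \<bullet> x"
    define A where "A = R' \<circ> D \<circ> R"
    have linA: "linear A" unfolding A_def using linR linR' D(1) by (intro linear_compose)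
    have "matrix A = matrix R' ** matrix D ** matrix R"
      unfolding A_def using linR linR' D(1) by (simp add: matrix_compose linear_compose matrix_mul_assoc o_assoc)
    moreover have "det (matrix R') * det (matrix R) = 1"
    proof -
      have "matrix R' ** matrix R = matrix (R' \<circ> R)" using linR linR' by (simp add: matrix_compose)
      also have "R' \<circ> R = id" using RR' by auto
      finally show ?thesis by (metis det_mul det_I matrix_id_mat_1)
    qed
    ultimately have "det (matrix A) = det (matrix D)" by (simp add: det_mul mult_ac)
    moreover have "A (?e 3) = ?e 3" unfolding A_def o_apply R(2) D(2) R'x ..
    moreover have "A v $ 3 = v $ 3" for v
      using D(3)[of "R v"] innerR[of "R' (D (R v))" "?e 3"] innerR[of v "?e 3"] R(2) RR'
      by (simp add: A_def inner_axis)
    moreover have "\<pi> (D (J w)) = Complex (A (Re w *\<^sub>R ?e 1 + Im w *\<^sub>R ?e 2) $ 1) (A (Re w *\<^sub>R ?e 1 + Im w *\<^sub>R ?e 2) $ 2)" for w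
      unfolding \<pi>_def J_def A_def by simp
    ultimately show "cdet (\<pi> \<circ> D \<circ> J) = det (matrix D)"
      by (simp add: cdet_def det_3 matrix_def axis_def)
  qed
  then show ?thesis by blast
qed

context tangent_frame
begin

lemma x_nonzero: "x \<noteq> 0" using norm_x by auto

lemma J_\<pi>: "v \<bullet> x = 0 \<Longrightarrow> J (\<pi> v) = v"
  using split[of v] by (simp add: inner_commute)

text \<open>
  The stabiliser of \<open>x\<close>, with the derivative at \<open>x\<close> recorded; \<open>act\<close> is the action of that derivative on
  the tangent plane, in the chosen coordinates.
\<close>

definition fixing :: "(real^3 \<Rightarrow> real^3) \<Rightarrow> (real^3 \<Rightarrow> real^3) \<Rightarrow> bool" where
  "fixing h D \<longleftrightarrow> conical h \<and> h x = x \<and> (h has_derivative D) (at x)"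

definition act :: "(real^3 \<Rightarrow> real^3) \<Rightarrow> complex \<Rightarrow> complex" where
  "act D = \<pi> \<circ> D \<circ> J"

lemma fixing_exists: "conical h \<Longrightarrow> h x = x \<Longrightarrow> \<exists>D. fixing h D"
  unfolding fixing_def using conical_derivative[OF _ x_nonzero] by metis

lemma fixing_derivative:
  assumes "fixing h D"
  shows "linear D" "D x = x" "D v \<bullet> x = v \<bullet> x"
  using assms has_derivative_linear conical_derivative_radial[of h D x] conical_derivative_inner[of h D x v]
  unfolding fixing_def by auto

lemma linear_act: "fixing h D \<Longrightarrow> linear (act D)"
  unfolding act_def by (intro linear_compose linear_J linear_\<pi> fixing_derivative)

lemma cdet_act_pos: "fixing h D \<Longrightarrow> cdet (act D) > 0"
  unfolding act_def using cdet_conj[of D] fixing_derivative[of h D] conicalD(4)[of h x D] x_nonzero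
  by (simp add: fixing_def)

lemma J_act: "fixing h D \<Longrightarrow> J (act D w) = D (J w)"
  unfolding act_def o_apply by (rule J_\<pi>) (simp add: fixing_derivative J_orthogonal)

lemma act_compose: "fixing h D \<Longrightarrow> act (E \<circ> D) = act E \<circ> act D"
  using J_act[of h D] by (simp add: act_def fun_eq_iff)

lemma act_eq_id_imp:
  assumes "fixing h D" "act D = id" shows "D = id"
proof
  fix y
  have "D (J w) = J w" for w using J_act[OF assms(1), of w] assms(2) by simp
  moreover have "D y = D ((x \<bullet> y) *\<^sub>R x + J (\<pi> y))" by (subst split[of y]) (rule refl)
  ultimately have "D y = (x \<bullet> y) *\<^sub>R x + J (\<pi> y)"
    by (simp only: linear_add linear_scale fixing_derivative[OF assms(1)])
  then show "D y = id y" using split[of y] by simp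
qed

lemma act_funpow: "fixing h D \<Longrightarrow> act (D ^^ n) = act D ^^ n"
proof (induction n)
  case 0 show ?case using \<pi>_J by (simp add: act_def fun_eq_iff)
next
  case (Suc n) then show ?case
    using act_compose[OF Suc.prems, of "D ^^ n"] by (simp only: funpow_Suc_right)
qed

lemma act_finite_order:
  assumes D: "fixing h D" and n: "h ^^ n = id" "n > 0"
  shows "act D ^^ n = id" "cdet (act D) = 1"
proof -
  have "(h ^^ k) x = x \<and> ((h ^^ k) has_derivative D ^^ k) (at x)" for k
  proof (induction k)
    case 0 show ?case by (simp add: id_def)
  next
    case (Suc k)
    then show ?case
      using D diff_chain_at[of "h ^^ k" "D ^^ k" x h D] by (simp add: fixing_def o_def)
  qed
  then have "(id has_derivative D ^^ n) (at x)" using n(1) by metis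
  moreover have "((id :: real^3 \<Rightarrow> _) has_derivative id) (at x)" by (simp add: id_def)
  ultimately have "D ^^ n = id" by (rule has_derivative_unique)
  moreover have "act id = id" using \<pi>_J by (simp add: act_def fun_eq_iff)
  ultimately show "act D ^^ n = id" using act_funpow[OF D, of n] by simp
  then show "cdet (act D) = 1"
    using cdet_eq_1[OF linear_act[OF D] _ n(2) cdet_act_pos[OF D]] by blast
qed

end

section \<open>Isolated fixed points and commuting stabilisers\<close>

lemma conical_tangent_to_id_locally:
  assumes h: "conical h" "n > 0" "h ^^ n = id"
    and x: "x \<noteq> 0" "h x = x" "(h has_derivative id) (at x)"
  shows "\<exists>e>0. \<forall>y\<in>ball x e. h y = y"
proof (rule finite_order_C1_tangent_to_id)
  show "open (- {0 :: real^3})" by (intro open_Compl closed_singleton)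
  show "h ` (- {0}) \<subseteq> - {0}"
    unfolding image_subset_iff using conical_nonzero[OF h(1)] by blast
  show "(h ^^ n) y = y" for y using h(3) by simp
qed (use h x conicalD(3) in auto)

text \<open>
  If the derivative \<open>D\<close> at \<open>x\<close> fixed no non-zero tangent vector, the map
  \<open>k y = h y - y + (x \<bullet> y) x\<close> would have an injective derivative at \<open>x\<close>. But a fixed unit vector \<open>y\<close>
  close to \<open>x\<close> and its projection \<open>(x \<bullet> y) x\<close> to the axis have the same image under \<open>k\<close>. So \<open>D\<close> fixes a
  non-zero tangent vector; having finite order and determinant \<open>1\<close>, it is the identity, and averaging applies.
\<close>

lemma (in tangent_frame) locally_id_of_fixed_limit:
  assumes h: "conical h" "n > 0" "h ^^ n = id"
    and lim: "x islimpt {y \<in> sphere 0 1. h y = y}"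
  shows "\<exists>e>0. \<forall>y\<in>ball x e. h y = y"
proof -
  have fixed: "h x = x"
  proof -
    have "isCont h x" by (rule conical_continuous[OF h(1) x_nonzero])
    moreover obtain s where s: "\<And>k. s k \<in> {y \<in> sphere 0 1. h y = y} - {x}" "s \<longlonglongrightarrow> x"
      using lim unfolding islimpt_sequential by blast
    ultimately have "(\<lambda>k. h (s k)) \<longlonglongrightarrow> h x" using isCont_tendsto_compose by blast
    moreover have "(\<lambda>k. h (s k)) = s" using s(1) by (auto simp: fun_eq_iff)
    ultimately show ?thesis using s(2) LIMSEQ_unique by metis
  qed
  obtain D where D: "fixing h D" using fixing_exists[OF h(1) fixed] by blast
  have hD: "(h has_derivative D) (at x)" using D by (simp add: fixing_def)
  note lin = fixing_derivative[OF D]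
  have T: "linear (act D)" "act D ^^ n = id" "cdet (act D) = 1"
    using linear_act[OF D] act_finite_order[OF D h(3,2)] by auto
  have "ctrace (act D) = 2"
  proof (rule ccontr)
    assume "ctrace (act D) \<noteq> 2"
    moreover have "cdet (\<lambda>w. act D w - w) = 2 - ctrace (act D)"
      using T(3) by (simp add: cdet_def ctrace_def algebra_simps)
    ultimately have nz: "cdet (\<lambda>w. act D w - w) \<noteq> 0" by simp
    \<comment> \<open>The last summand makes the derivative injective in the radial direction, where \<open>D\<close> is the
      identity.\<close>
    define k where "k y = h y - y + (x \<bullet> y) *\<^sub>R x" for y
    define K where "K v = D v - v + (x \<bullet> v) *\<^sub>R x" for v
    have linK: "linear K" unfolding K_def
      by (rule linearI) (simp_all add: linear_add[OF lin(1)] linear_scale[OF lin(1)] inner_add_right algebra_simps)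
    have "inj K"
    proof (subst linear_injective_0[OF linK], intro allI impI)
      fix v assume K0: "K v = 0"
      have "K v \<bullet> x = x \<bullet> v"
        unfolding K_def using lin(3)[of v] norm_x
        by (simp add: inner_add_left inner_diff_left dot_square_norm)
      then have xv: "x \<bullet> v = 0" using K0 by simp
      then have "D v = v" using K0 unfolding K_def by simp
      moreover have v: "J (\<pi> v) = v" using xv J_\<pi> by (simp add: inner_commute)
      ultimately have "act D (\<pi> v) - \<pi> v = 0" by (simp add: act_def)
      then have "\<pi> v = 0"
        using cdet_nonzero_inj[OF linear_compose_sub[OF T(1) linear_id] _ ] nz by simp
      then show "v = 0" using v linear_0[OF linear_J] by simp
    qed
    moreover have "C1_on (- {0}) k"
    proof -
      have "C1_on (- {0}) (\<lambda>y. (- 1) *\<^sub>R y :: real^3)" by (intro C1_on_scaleR C1_on_const C1_on_id)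
      moreover have "C1_on (- {0}) (\<lambda>y. x \<bullet> y)"
        by (rule C1_onI[of _ _ "\<lambda>_. blinfun_inner_right x"])
           (auto intro!: has_derivative_inner_right has_derivative_ident)
      ultimately have "C1_on (- {0}) (\<lambda>y. h y + (- 1) *\<^sub>R y + (x \<bullet> y) *\<^sub>R x)"
        by (intro C1_on_add C1_on_scaleR[of _ "\<lambda>y. x \<bullet> y"] C1_on_const conicalD(3)[OF h(1)])
      then show ?thesis unfolding k_def by (rule C1_on_cong) simp
    qed
    moreover have "(k has_derivative K) (at x)"
      unfolding k_def K_def
      by (auto intro!: derivative_eq_intros hD)
    ultimately obtain r where r: "r > 0" "inj_on k (ball x r)"
      using C1_on_locally_injective[of "- {0}" k x K] x_nonzero by auto
    obtain y where y: "y \<in> sphere 0 1" "h y = y" "y \<noteq> x" "dist y x < min r 1"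
      using lim r(1) unfolding islimpt_approachable by (metis (mono_tags, lifting) mem_Collect_eq min_less_iff_conj zero_less_one)
    have ny: "norm y = 1" using y(1) by simp
    define c where "c = x \<bullet> y"
    have c: "(dist y x)\<^sup>2 = 2 - 2 * c"
    proof -
      have "y \<bullet> y = 1" "x \<bullet> x = 1" using ny norm_x by (simp_all add: dot_square_norm)
      then show ?thesis
        unfolding dist_norm power2_norm_eq_inner c_def inner_diff_left inner_diff_right
        using inner_commute[of x y] by linarith
    qed
    have d1: "dist y x < 1" "dist y x < r" using y(4) by auto
    have "(dist y x)\<^sup>2 \<le> dist y x"
      using d1 by (simp add: power2_eq_square mult_left_le)
    then have c01: "2 - 2 * c \<le> dist y x" using c by simp
    then have c0: "c > 0" using d1(1) by simp
    have c1: "c \<le> 1" using c zero_le_power2[of "dist y x"] by linarith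
    have "dist x (c *\<^sub>R x) = 1 - c"
    proof -
      have "x - c *\<^sub>R x = (1 - c) *\<^sub>R x" by (simp add: algebra_simps)
      then show ?thesis using c1 norm_x by (simp add: dist_norm)
    qed
    then have "c *\<^sub>R x \<in> ball x r" using c01 d1 c1 by simp
    moreover have "y \<in> ball x r" using d1 by (simp add: dist_commute)
    moreover have "k y = c *\<^sub>R x" unfolding k_def y(2) c_def by simp
    moreover have "k (c *\<^sub>R x) = c *\<^sub>R x"
      unfolding k_def using conicalD(2)[OF h(1), of c x] c0 fixed norm_x
      by (simp add: dot_square_norm)
    ultimately have "y = c *\<^sub>R x" using r(2) by (metis inj_onD)
    then have "c = 1" using ny norm_x c0 by simp
    then show False using \<open>y = c *\<^sub>R x\<close> y(3) by simp
  qed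
  then have "act D = id" using ctrace_2_imp_id[OF T(1,3,2) h(2)] by blast
  then have "D = id" using act_eq_id_imp[OF D] by blast
  with hD have "(h has_derivative id) (at x)" by simp
  then show ?thesis by (rule conical_tangent_to_id_locally[OF h x_nonzero fixed])
qed

lemma sphere_islimpt:
  fixes x :: "'a::euclidean_space" assumes "2 \<le> DIM('a)" "x \<in> sphere 0 1" shows "x islimpt sphere 0 1"
proof (rule connected_imp_perfect[OF connected_sphere[OF assms(1)] assms(2)])
  fix z :: 'a
  show "sphere 0 1 \<noteq> {z}"
  proof
    assume s: "sphere 0 1 = {z}"
    have "x \<in> {z}" "- x \<in> {z}" using assms(2) unfolding s[symmetric] by simp_all
    then have "x = - x" by (simp only: singleton_iff)
    then show False using assms(2) by (simp add: eq_neg_iff_add_eq_0 flip: scaleR_2)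
  qed
qed

lemma conical_eq_id:
  assumes "conical h" "\<And>y. norm y = 1 \<Longrightarrow> h y = y" shows "h = id"
proof
  fix y
  show "h y = id y"
  proof (cases "y = 0")
    case True then show ?thesis using conicalD(1)[OF assms(1), of 0] by simp
  next
    case False
    have "h (norm y *\<^sub>R (y /\<^sub>R norm y)) = norm y *\<^sub>R h (y /\<^sub>R norm y)"
      by (rule conicalD(2)[OF assms(1)]) simp
    then show ?thesis using assms(2)[of "y /\<^sub>R norm y"] False by simp
  qed
qed

text \<open>
  The accumulation points of the fixed point set form a closed subset of the sphere. By the local
  statement above a neighbourhood of such a point is fixed pointwise, so the subset is also open. If there
  are infinitely many fixed points it is nonempty by compactness, hence the whole sphere by
  connectedness.
\<close>

lemma finite_order_fixed_points_finite:
  assumes h: "conical h" "n > 0" "h ^^ n = id" and "h \<noteq> id"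
  shows "finite {y \<in> sphere 0 1. h y = y}"
proof (rule ccontr)
  let ?S = "sphere 0 1 :: (real^3) set"
  let ?F = "{y \<in> ?S. h y = y}"
  let ?L = "{x \<in> ?S. x islimpt ?F}"
  assume "infinite ?F"
  then have "\<exists>x\<in>?S. x islimpt ?F"
    by (intro Heine_Borel_imp_Bolzano_Weierstrass compact_sphere) auto
  then obtain x where x: "x \<in> ?L" by blast
  have loc: "\<exists>e>0. \<forall>y\<in>ball x e. h y = y" if "x \<in> ?L" for x
  proof -
    from that have "norm x = 1" by simp
    then obtain J \<pi> where "tangent_frame x J \<pi>" using tangent_frame_exists by blast
    then show ?thesis using tangent_frame.locally_id_of_fixed_limit[OF _ h] that by blast
  qed
  have "?L = ?S \<inter> {x. x islimpt ?F}" by blast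
  then have "closedin (top_of_set ?S) ?L"
    using closedin_closed_Int[OF closed_limpts, of ?S ?F] by (simp only:)
  moreover have "openin (top_of_set ?S) ?L"
    unfolding openin_contains_ball
  proof (intro conjI ballI)
    fix x assume x: "x \<in> ?L"
    then obtain e where e: "e > 0" "\<forall>y\<in>ball x e. h y = y" using loc by blast
    have "z \<in> ?L" if "z \<in> ball x e \<inter> ?S" for z
    proof -
      have "z islimpt (?S \<inter> ball x e)"
        using sphere_islimpt[of z] that by (intro islimpt_Int_eventually) (auto simp: eventually_at_topological)
      then have "z islimpt ?F" by (rule islimpt_subset) (use e in auto)
      then show ?thesis using that by simp
    qed
    then show "\<exists>e>0. ball x e \<inter> ?S \<subseteq> ?L" using e(1) by blast
  qed auto
  ultimately have "?L = ?S"
    using connected_sphere[of "0::real^3" 1] x unfolding connected_clopen by (auto 0 3)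
  then have "h y = y" if "norm y = 1" for y using loc[of y] that by auto
  then have "h = id" using conical_eq_id[OF h(1)] by blast
  with assms(4) show False by blast
qed

lemma finite_order_tangent_to_id:
  assumes h: "conical h" "n > 0" "h ^^ n = id"
    and x: "norm x = 1" "h x = x" "(h has_derivative id) (at x)"
  shows "h = id"
proof (rule ccontr)
  assume "h \<noteq> id"
  then have fin: "finite {y \<in> sphere 0 1. h y = y}" using finite_order_fixed_points_finite[OF h] by blast
  have "\<exists>e>0. \<forall>y\<in>ball x e. h y = y"
    using x(1) by (intro conical_tangent_to_id_locally[OF h _ x(2,3)]) auto
  then obtain e where e: "e > 0" "\<forall>y\<in>ball x e. h y = y" by blast
  have "infinite (sphere 0 1 \<inter> ball x e)"
    using sphere_islimpt[of x] x(1) e(1) islimpt_eq_infinite_ball[of x "sphere 0 1"] by simp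
  moreover have "sphere 0 1 \<inter> ball x e \<subseteq> {y \<in> sphere 0 1. h y = y}" using e by auto
  ultimately show False using fin finite_subset by blast
qed

text \<open>
  The derivatives at \<open>x\<close> of two elements and of their commutator \<open>k\<close> act on the tangent plane with
  finite order and determinant \<open>1\<close>, so the two derivatives commute. Then \<open>k\<close> is tangent to the identity,
  which makes it trivial.
\<close>

lemma (in tangent_frame) finite_order_commute:
  assumes a: "conical a" "a x = x" "a ^^ n = id" "n > 0"
    and b: "conical b" "b x = x" "b ^^ m = id" "m > 0"
    and k: "conical k" "k x = x" "k ^^ l = id" "l > 0"
    and kba: "k \<circ> b \<circ> a = a \<circ> b"
  shows "a \<circ> b = b \<circ> a"
proof -
  obtain A where A: "fixing a A" using fixing_exists a by blast
  obtain B where B: "fixing b B" using fixing_exists b by blast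
  obtain K where K: "fixing k K" using fixing_exists k by blast
  have der: "(a has_derivative A) (at x)" "(b has_derivative B) (at x)" "(k has_derivative K) (at x)"
    using A B K by (auto simp: fixing_def)
  have "((a \<circ> b) has_derivative (A \<circ> B)) (at x)" using der a(2) b(2) by (intro diff_chain_at) auto
  moreover have "((k \<circ> (b \<circ> a)) has_derivative (K \<circ> (B \<circ> A))) (at x)"
    using der a(2) b(2) k(2) by (intro diff_chain_at) auto
  ultimately have KBA: "K \<circ> (B \<circ> A) = A \<circ> B" using kba has_derivative_unique by (metis o_assoc)
  then have act: "act K \<circ> act B \<circ> act A = act A \<circ> act B"
    using act_compose[OF A, of "K \<circ> B"] act_compose[OF B, of K] act_compose[OF B, of A] by (metis o_assoc)
  have comm: "act A \<circ> act B = act B \<circ> act A"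
    by (rule finite_order_commutator[OF linear_act[OF A] act_finite_order(2)[OF A a(3,4)] act_finite_order(1)[OF A a(3,4)] a(4)
        linear_act[OF B] act_finite_order(2)[OF B b(3,4)]
        linear_act[OF K] act_finite_order(2)[OF K k(3,4)] act_finite_order(1)[OF K k(3,4)] k(4) act])
  have "act K w = w" for w
  proof -
    have inv: "act A ((act A ^^ (n - 1)) z) = z" "act B ((act B ^^ (m - 1)) z) = z" for z
      using act_finite_order(1)[OF A a(3,4)] act_finite_order(1)[OF B b(3,4)] a(4) b(4)
      by (metis Suc_diff_1 comp_apply funpow.simps(2) id_apply)+
    define u where "u = (act A ^^ (n - 1)) ((act B ^^ (m - 1)) w)"
    have "act B (act A u) = w" unfolding u_def inv ..
    moreover have "act K (act B (act A u)) = act B (act A u)" using act comm by (metis comp_apply)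
    ultimately show ?thesis by simp
  qed
  then have "act K = id" by auto
  then have "K = id" by (rule act_eq_id_imp[OF K])
  then have "k = id" using finite_order_tangent_to_id[OF k(1,4,3) norm_x k(2)] der(3) by simp
  with kba show ?thesis by simp
qed

section \<open>Existence of a fixed point\<close>

definition sqnorm :: "complex \<Rightarrow> real" where "sqnorm z = (Re z)\<^sup>2 + (Im z)\<^sup>2"

text \<open>
  The inverse of the stereographic projection from the north pole, scaled by the factor
  \<open>1 + sqnorm z\<close> to make it polynomial; \<open>stereo'\<close> is its derivative.
\<close>

definition stereo :: "complex \<Rightarrow> real^3" where
  "stereo z = (2 * Re z) *\<^sub>R axis 1 1 + (2 * Im z) *\<^sub>R axis 2 1 + (sqnorm z - 1) *\<^sub>R axis 3 1"

definition stereo' :: "complex \<Rightarrow> complex \<Rightarrow> real^3" where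
  "stereo' b w = (2 * Re w) *\<^sub>R axis 1 1 + (2 * Im w) *\<^sub>R axis 2 1 + (2 * (Re b * Re w + Im b * Im w)) *\<^sub>R axis 3 1"

lemma stereo_nth [simp]:
  "stereo z $ 1 = 2 * Re z" "stereo z $ 2 = 2 * Im z" "stereo z $ 3 = sqnorm z - 1"
  by (simp_all add: stereo_def axis_def)

lemma stereo'_nth [simp]:
  "stereo' b w $ 1 = 2 * Re w" "stereo' b w $ 2 = 2 * Im w" "stereo' b w $ 3 = 2 * (Re b * Re w + Im b * Im w)"
  by (simp_all add: stereo'_def axis_def)

lemma sqnorm_nonneg: "sqnorm z \<ge> 0" by (simp add: sqnorm_def)

lemma inner_3: "(x::real^3) \<bullet> y = x$1 * y$1 + x$2 * y$2 + x$3 * y$3"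
  by (simp add: inner_vec_def sum_3)

lemma norm_3: "(norm (x::real^3))\<^sup>2 = (x$1)\<^sup>2 + (x$2)\<^sup>2 + (x$3)\<^sup>2"
  unfolding power2_norm_eq_inner inner_3 by (simp add: power2_eq_square)

lemma norm_stereo: "norm (stereo z) = 1 + sqnorm z"
proof -
  have "(norm (stereo z))\<^sup>2 = (1 + sqnorm z)\<^sup>2"
    unfolding norm_3 stereo_nth by (simp add: power2_eq_square sqnorm_def algebra_simps)
  then show ?thesis using sqnorm_nonneg[of z] by (simp add: power2_eq_iff_nonneg)
qed

lemma stereo_nonzero: "stereo z \<noteq> 0"
  using norm_stereo[of z] sqnorm_nonneg[of z] by auto

lemma sqnorm_has_derivative:
  "(sqnorm has_derivative (\<lambda>w. 2 * (Re b * Re w + Im b * Im w))) (at b)"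
  unfolding sqnorm_def[abs_def]
  by (auto intro!: derivative_eq_intros has_derivative_Re has_derivative_Im simp: algebra_simps)

lemma stereo_has_derivative: "(stereo has_derivative stereo' b) (at b)"
proof -
  have "(stereo has_derivative (\<lambda>w. (2 * Re w) *\<^sub>R axis 1 1 + (2 * Im w) *\<^sub>R axis 2 1
     + (2 * (Re b * Re w + Im b * Im w) - 0) *\<^sub>R axis 3 1)) (at b)"
    unfolding stereo_def[abs_def]
    by (intro has_derivative_add has_derivative_scaleR_left has_derivative_diff sqnorm_has_derivative
        has_derivative_mult_right has_derivative_Re has_derivative_Im has_derivative_ident has_derivative_const)
  then show ?thesis by (simp add: stereo'_def[abs_def])
qed

text \<open>
  The inverse stereographic projection from the north pole reverses orientation with respect to the
  outward normal.
\<close>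

lemma det_stereo:
  "det (vector [stereo b, stereo' b 1, stereo' b \<i>] :: real^3^3) < 0"
proof -
  have "det (vector [stereo b, stereo' b 1, stereo' b \<i>] :: real^3^3) = - 4 * (1 + sqnorm b)"
    by (simp add: det_3 sqnorm_def power2_eq_square algebra_simps)
  then show ?thesis using sqnorm_nonneg[of b] by simp
qed

lemma det_rows_image:
  fixes D :: "real^3 \<Rightarrow> real^3"
  assumes "linear D"
  shows "det (vector [D u, D v, D w] :: real^3^3) = det (matrix D) * det (vector [u, v, w] :: real^3^3)"
proof -
  have "D y $ i = (\<Sum>j\<in>UNIV. matrix D $ i $ j * y $ j)" for y i
  proof -
    have "D y = matrix D *v y" using matrix_vector_mul(2)[OF assms] by metis
    then show ?thesis by (simp add: matrix_vector_mult_def)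
  qed
  then have "(vector [D u, D v, D w] :: real^3^3) = vector [u, v, w] ** transpose (matrix D)"
    by (simp add: vec_eq_iff forall_3 matrix_matrix_mult_def transpose_def sum_3 mult.commute)
  then show ?thesis by (simp add: det_mul det_transpose)
qed

definition horizontal :: "real^3 \<Rightarrow> complex" where
  "horizontal v = (v $ 1) *\<^sub>R 1 + (v $ 2) *\<^sub>R \<i>"

lemma horizontal_simps [simp]: "Re (horizontal v) = v $ 1" "Im (horizontal v) = v $ 2"
  by (simp_all add: horizontal_def)

lemma linear_horizontal: "linear horizontal"
  by (rule linearI) (simp_all add: complex_eq_iff)

lemma axis3_nth [simp]: "(axis 3 1 :: real^3) $ 1 = 0" "(axis 3 1 :: real^3) $ 2 = 0" "(axis 3 1 :: real^3) $ 3 = 1"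
  by (simp_all add: axis_def)

text \<open>
  The second hypothesis says that \<open>Q\<close> has stereographic coordinate \<open>z\<close>, with the denominator cleared.
  This adds the pole, where numerator and denominator vanish, to the solutions.
\<close>

lemma stereo_ratio_unique:
  assumes "norm Q = 1 + sqnorm z" "horizontal Q = of_real (1 + sqnorm z - Q $ 3) * z"
  shows "Q = (1 + sqnorm z) *\<^sub>R axis 3 1 \<or> Q = stereo z"
proof -
  define r where "r = 1 + sqnorm z"
  have Q12: "Q $ 1 = (r - Q $ 3) * Re z" "Q $ 2 = (r - Q $ 3) * Im z"
    using assms(2) unfolding r_def by (simp_all add: complex_eq_iff)
  have "r\<^sup>2 = (Q$1)\<^sup>2 + (Q$2)\<^sup>2 + (Q$3)\<^sup>2" using norm_3[of Q] assms(1) r_def by simp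
  then have "(r - Q $ 3) * (r + Q $ 3) = (r - Q $ 3) * ((r - Q $ 3) * sqnorm z)"
    unfolding Q12 sqnorm_def by (simp add: power2_eq_square algebra_simps)
  then consider "r - Q $ 3 = 0" | "r + Q $ 3 = (r - Q $ 3) * sqnorm z" by auto
  then show ?thesis
  proof cases
    case 1
    then have "Q = r *\<^sub>R axis 3 1" using Q12 by (simp add: vec_eq_iff forall_3)
    then show ?thesis by (simp add: r_def)
  next
    case 2
    then have "(1 + sqnorm z) * (Q $ 3) = (1 + sqnorm z) * (sqnorm z - 1)"
      unfolding r_def by (simp add: algebra_simps)
    then have "Q $ 3 = sqnorm z - 1" using sqnorm_nonneg[of z] by (metis mult_left_cancel add_pos_nonneg less_irrefl zero_less_one)
    then have "Q = stereo z" using Q12 r_def by (simp add: vec_eq_iff forall_3)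
    then show ?thesis by simp
  qed
qed

lemma sphere_below_pole:
  fixes B :: "real^3"
  assumes "norm B = 1" "B \<noteq> axis 3 1"
  shows "B $ 3 < 1"
proof (rule ccontr)
  have nB: "(B$1)\<^sup>2 + (B$2)\<^sup>2 + (B$3)\<^sup>2 = 1" using norm_3[of B] assms(1) by simp
  assume "\<not> B $ 3 < 1"
  then have "(B $ 3)\<^sup>2 \<ge> 1" by simp
  then have "(B$1)\<^sup>2 + (B$2)\<^sup>2 \<le> 0" using nB by simp
  then have 0: "B $ 1 = 0" "B $ 2 = 0" by (simp_all add: sum_power2_le_zero_iff)
  then have "(B $ 3)\<^sup>2 = 1" using nB by simp
  then have "B $ 3 = 1" using \<open>\<not> B $ 3 < 1\<close> by (simp add: power2_eq_1_iff)
  then show False using 0 assms(2) by (simp add: vec_eq_iff forall_3)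
qed

lemma stereo_surj:
  assumes "norm B = 1" "B \<noteq> axis 3 1"
  obtains b where "stereo b = (1 + sqnorm b) *\<^sub>R B"
proof -
  have nB: "(B$1)\<^sup>2 + (B$2)\<^sup>2 + (B$3)\<^sup>2 = 1" using norm_3[of B] assms(1) by simp
  have "B $ 3 < 1" by (rule sphere_below_pole[OF assms])
  define d where "d = 1 - B $ 3"
  have d: "d > 0" using \<open>B $ 3 < 1\<close> d_def by simp
  define b where "b = Complex (B$1 / d) (B$2 / d)"
  have "d * d * sqnorm b = (B$1)\<^sup>2 + (B$2)\<^sup>2"
    using d by (simp add: b_def sqnorm_def power2_eq_square field_simps)
  also have "\<dots> = d * (2 - d)" using nB by (simp add: d_def power2_eq_square algebra_simps)
  finally have "d * sqnorm b = 2 - d" using d by (simp add: mult.assoc)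
  then have q: "sqnorm b = (2 - d) / d" using d by (simp add: field_simps)
  have B3: "B $ 3 = 1 - d" by (simp add: d_def)
  have "stereo b = (1 + sqnorm b) *\<^sub>R B"
    unfolding vec_eq_iff forall_3 stereo_nth vector_scaleR_component q B3
    using d by (simp add: b_def field_simps)
  then show ?thesis by (rule that)
qed

text \<open>
  In the stereographic coordinate \<open>z\<close> from the north pole \<open>N\<close> let \<open>g\<close> be the map induced by \<open>h\<close>. The
  function \<open>g z - z\<close> has a pole at the point \<open>b\<close> that corresponds to the preimage \<open>B\<close> of \<open>N\<close>. Multiplied
  by a nonnegative function whose only zero is \<open>b\<close>, it becomes a differentiable function \<open>G\<close> on the whole
  plane. If \<open>h\<close> has no fixed point, \<open>b\<close> is the only zero of \<open>G\<close>; near infinity \<open>G\<close> points towards the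
  origin, since \<open>g\<close> stays bounded there; and at \<open>b\<close> the derivative reverses orientation, since \<open>h\<close>
  preserves it, the inverse stereographic projection reverses it, and the projection to the horizontal
  plane preserves it at \<open>N\<close>. Winding numbers exclude this.
\<close>

lemma conical_has_fixed_point:
  assumes h: "conical h" "bij h"
  shows "\<exists>x\<in>sphere 0 1. h x = x"
proof (rule ccontr)
  assume "\<not> ?thesis"
  then have nofix: "h x \<noteq> x" if "norm x = 1" for x using that by auto
  have nofix': "h x \<noteq> x" if "x \<noteq> 0" for x
  proof
    assume "h x = x"
    then have "h (x /\<^sub>R norm x) = x /\<^sub>R norm x" using conicalD(2)[OF h(1), of "inverse (norm x)" x] by simp
    then show False using nofix[of "x /\<^sub>R norm x"] that by simp
  qed
  let ?N = "axis 3 1 :: real^3"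
  have nN: "norm ?N = 1" by simp
  obtain B where B: "h B = ?N" using h(2) by (metis bij_pointE)
  have nB: "norm B = 1" using conicalD(1)[OF h(1), of B] B nN by simp
  have BN: "B \<noteq> ?N" using nofix[OF nN] B by auto
  obtain b where b: "stereo b = (1 + sqnorm b) *\<^sub>R B" using stereo_surj[OF nB BN] by blast
  let ?Q = "\<lambda>z. h (stereo z)"
  have scale: "h ((1 + sqnorm z) *\<^sub>R y) = (1 + sqnorm z) *\<^sub>R h y" for z y
    using conicalD(2)[OF h(1)] sqnorm_nonneg[of z] by simp
  have Qb: "?Q b = (1 + sqnorm b) *\<^sub>R ?N" unfolding b scale B ..
  have nQ: "norm (?Q z) = 1 + sqnorm z" for z using conicalD(1)[OF h(1)] norm_stereo by simp
  \<comment> \<open>\<open>g z - z\<close> times the denominator of the stereographic coordinate of \<open>?Q z\<close>\<close>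
  define G where "G z = horizontal (?Q z) - (1 + sqnorm z - ?Q z $ 3) *\<^sub>R z" for z
  have Gb: "G b = 0" unfolding G_def Qb by (simp add: complex_eq_iff)
  have Gnz: "G z \<noteq> 0" if "z \<noteq> b" for z
  proof
    assume "G z = 0"
    then have "horizontal (?Q z) = of_real (1 + sqnorm z - ?Q z $ 3) * z"
      unfolding G_def by (simp add: scaleR_conv_of_real)
    from stereo_ratio_unique[OF nQ this]
    consider "?Q z = (1 + sqnorm z) *\<^sub>R ?N" | "?Q z = stereo z" by blast
    then show False
    proof cases
      case 1
      then have "?Q z = h ((1 + sqnorm z) *\<^sub>R B)" unfolding scale B .
      then have z: "stereo z = (1 + sqnorm z) *\<^sub>R B" using h(2) by (metis bij_is_inj injD)
      have "z = b"
      proof -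
        have e: "2 * Re w = (1 + sqnorm w) * B $ 1" "2 * Im w = (1 + sqnorm w) * B $ 2"
          "(1 + sqnorm w) * (1 - B $ 3) = 2" if "stereo w = (1 + sqnorm w) *\<^sub>R B" for w
          using arg_cong[OF that, of "\<lambda>v. v $ 1"] arg_cong[OF that, of "\<lambda>v. v $ 2"] arg_cong[OF that, of "\<lambda>v. v $ 3"]
          by (simp_all add: algebra_simps)
        have "1 - B $ 3 \<noteq> 0" using e(3)[OF b] by auto
        moreover from this have "1 + sqnorm z = 1 + sqnorm b" using e(3)[OF b] e(3)[OF z] by (metis mult_right_cancel)
        ultimately show ?thesis using e(1,2)[OF b] e(1,2)[OF z] by (simp add: complex_eq_iff)
      qed
      with that show False by simp
    next
      case 2
      then show False using nofix'[OF stereo_nonzero] by blast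
    qed
  qed
  have dQ: "\<exists>D. (h has_derivative D) (at (stereo z))" for z
    using conical_derivative[OF h(1) stereo_nonzero] by blast
  have dG: "(G has_derivative (\<lambda>w. horizontal (D (stereo' z w))
      - ((1 + sqnorm z - ?Q z $ 3) *\<^sub>R w + (0 + 2 * (Re z * Re w + Im z * Im w) - D (stereo' z w) $ 3) *\<^sub>R z))) (at z)"
    if D: "(h has_derivative D) (at (stereo z))" for z D
  proof -
    have Q: "(?Q has_derivative (\<lambda>w. D (stereo' z w))) (at z)"
      using diff_chain_at[OF stereo_has_derivative D] by (simp add: o_def)
    have "((\<lambda>z. horizontal (?Q z)) has_derivative (\<lambda>w. horizontal (D (stereo' z w)))) (at z)"
      using bounded_linear.has_derivative[OF _ Q] linear_horizontal by (simp add: linear_conv_bounded_linear)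
    moreover have "((\<lambda>z. ?Q z $ 3) has_derivative (\<lambda>w. D (stereo' z w) $ 3)) (at z)"
      using bounded_linear.has_derivative[OF bounded_linear_vec_nth Q] .
    ultimately show ?thesis unfolding G_def
      by (intro has_derivative_diff has_derivative_scaleR has_derivative_add has_derivative_const
          sqnorm_has_derivative has_derivative_ident)
  qed
  have cont: "continuous_on UNIV G"
    using dQ dG by (meson continuous_at_imp_continuous_on has_derivative_continuous)
  obtain D where D: "(h has_derivative D) (at (stereo b))" using dQ by blast
  have linD: "linear D" using D by (rule has_derivative_linear)
  have D3: "D (stereo' b w) $ 3 = 2 * (Re b * Re w + Im b * Im w)" for w
  proof -
    have "(1 + sqnorm b) * (D (stereo' b w) $ 3) = D (stereo' b w) \<bullet> h (stereo b)"
      unfolding Qb by (simp add: inner_3)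
    also have "\<dots> = stereo' b w \<bullet> stereo b" by (rule conical_derivative_inner[OF h(1) D])
    also have "\<dots> = (1 + sqnorm b) * (2 * (Re b * Re w + Im b * Im w))"
      by (simp add: inner_3 algebra_simps)
    finally show ?thesis using sqnorm_nonneg[of b] by (metis mult_left_cancel add_pos_nonneg less_irrefl zero_less_one)
  qed
  let ?L = "\<lambda>w. horizontal (D (stereo' b w))"
  \<comment> \<open>The denominator has a zero of second order at \<open>b\<close>, so only the horizontal part of \<open>D\<close> remains.\<close>
  have "(G has_derivative ?L) (at b)" using dG[OF D] unfolding D3 Qb by simp
  moreover have "cdet ?L < 0"
  proof -
    have "det (vector [D (stereo b), D (stereo' b 1), D (stereo' b \<i>)] :: real^3^3) < 0"
      unfolding det_rows_image[OF linD] using det_stereo conicalD(4)[OF h(1) stereo_nonzero D]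
      by (simp add: mult_pos_neg)
    also have "D (stereo b) = (1 + sqnorm b) *\<^sub>R ?N"
      using conical_derivative_radial[OF h(1) D] Qb by simp
    finally have "(1 + sqnorm b) * cdet ?L < 0"
      by (simp add: det_3 cdet_def algebra_simps)
    then show ?thesis using sqnorm_nonneg[of b] by (simp add: mult_less_0_iff)
  qed
  moreover obtain R where "\<And>z. norm z > R \<Longrightarrow> Re (cnj z * G z) < 0"
  proof -
    \<comment> \<open>For large \<open>z\<close> the point \<open>y\<close> on the sphere with coordinate \<open>z\<close> is close to the pole, so \<open>h y\<close> stays at
      height at most \<open>1 - \<delta>\<close>.\<close>
    define \<delta> where "\<delta> = (1 - h ?N $ 3) / 2"
    have "h ?N $ 3 < 1"
      using conicalD(1)[OF h(1), of ?N] nN nofix[OF nN] by (intro sphere_below_pole) auto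
    then have \<delta>: "\<delta> > 0" by (simp add: \<delta>_def)
    have "isCont (\<lambda>y. h y $ 3) ?N"
      using conical_continuous[OF h(1), of ?N] nN by (intro continuous_intros) auto
    then obtain e where e: "e > 0" "\<And>y. dist y ?N < e \<Longrightarrow> dist (h y $ 3) (h ?N $ 3) < \<delta>"
      unfolding continuous_at_eps_delta using \<delta> by blast
    have "Re (cnj z * G z) < 0" if z: "norm z > 1 / \<delta> + 2 / e" for z
    proof -
      define r where "r = 1 + sqnorm z"
      have r: "r > 0" using sqnorm_nonneg[of z] r_def by simp
      have nz: "sqnorm z = (norm z)\<^sup>2" by (simp add: sqnorm_def cmod_power2)
      have z1: "norm z > 1 / \<delta>" "norm z > 2 / e" "norm z > 0" using z \<delta> e(1) 
        by (smt (verit) divide_pos_pos)+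
      define y where "y = stereo z /\<^sub>R r"
      have y: "h y = ?Q z /\<^sub>R r" unfolding y_def using conicalD(2)[OF h(1)] r by simp
      have ny: "norm y = 1" unfolding y_def using norm_stereo[of z] r by (simp add: r_def)
      have "(dist y ?N)\<^sup>2 = (norm y)\<^sup>2 + 1 - 2 * y $ 3"
        unfolding dist_norm norm_3 by (simp add: power2_eq_square algebra_simps)
      also have "\<dots> = 4 / r"
        using r unfolding ny by (simp add: y_def r_def field_simps)
      also have "\<dots> < (2 / norm z)\<^sup>2"
        using r z1(3) nz by (simp add: r_def power_divide field_simps)
      finally have "dist y ?N < 2 / norm z" using z1(3) by (simp add: power2_less_imp_less)
      also have "\<dots> < e" using z1 e(1) by (simp add: field_simps)
      finally have "h y $ 3 < h ?N $ 3 + \<delta>" using e(2)[of y] by (simp add: dist_real_def)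
      also have "\<dots> = 1 - \<delta>" by (simp add: \<delta>_def field_simps)
      finally have "?Q z $ 3 < r * (1 - \<delta>)" using r y by (simp add: field_simps)
      then have "r - ?Q z $ 3 > r * \<delta>" by (simp add: algebra_simps)
      then have 1: "(norm z)\<^sup>2 * (r - ?Q z $ 3) > (norm z)\<^sup>2 * (r * \<delta>)" using z1(3) by simp
      have "norm (horizontal (?Q z)) \<le> norm (?Q z)"
      proof (rule power2_le_imp_le)
        show "(norm (horizontal (?Q z)))\<^sup>2 \<le> (norm (?Q z))\<^sup>2"
          unfolding cmod_power2 norm_3 by simp
      qed simp
      then have "Re (cnj z * horizontal (?Q z)) \<le> norm z * r"
        using complex_Re_le_cmod[of "cnj z * horizontal (?Q z)"] mult_left_mono[of "norm (horizontal (?Q z))" r "norm z"]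
        unfolding norm_mult complex_mod_cnj nQ r_def using norm_ge_zero[of z] by (meson order_trans)
      also have "norm z * r < norm z * r * (norm z * \<delta>)"
        using z1 r \<delta> by (simp add: field_simps)
      finally have "Re (cnj z * horizontal (?Q z)) < (norm z)\<^sup>2 * (r * \<delta>)"
        by (simp add: power2_eq_square mult_ac)
      moreover have "Re (cnj z * G z) = Re (cnj z * horizontal (?Q z)) - (norm z)\<^sup>2 * (r - ?Q z $ 3)"
        unfolding G_def nz[symmetric] r_def sqnorm_def by (simp add: power2_eq_square algebra_simps)
      ultimately show ?thesis using 1 by linarith
    qed
    then show ?thesis by (rule that)
  qed
  ultimately show False using no_orientation_reversing_single_zero[OF cont Gnz Gb] by blast
qed

section \<open>Periodic groups with an abelian subgroup of finite index\<close>

text \<open>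
  In a commutative periodic group each new generator \<open>b\<close> of order \<open>n\<close> only multiplies the set by
  \<open>b\<^sup>0, \<dots>, b\<^sup>n\<^sup>-\<^sup>1\<close>.
\<close>

lemma (in group) finite_right_closed_subset:
  assumes per: "periodic_group G" and H: "subgroup H G"
    and comm: "\<And>a b. a \<in> H \<Longrightarrow> b \<in> H \<Longrightarrow> a \<otimes> b = b \<otimes> a"
    and B: "finite B" "B \<subseteq> H"
  shows "\<exists>K. finite K \<and> K \<subseteq> H \<and> \<one> \<in> K \<and> (\<forall>k\<in>K. \<forall>b\<in>B. k \<otimes> b \<in> K)"
  using B
proof (induction B rule: finite_induct)
  case empty
  show ?case using subgroup.one_closed[OF H] by (intro exI[of _ "{\<one>}"]) auto
next
  case (insert b B)
  then have "B \<subseteq> H" by blast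
  from insert.IH[OF this] obtain K where K: "finite K" "K \<subseteq> H" "\<one> \<in> K" "\<forall>k\<in>K. \<forall>c\<in>B. k \<otimes> c \<in> K"
    by (elim exE conjE)
  have HG: "x \<in> carrier G" if "x \<in> H" for x using that subgroup.mem_carrier[OF H] by blast
  have bH: "b \<in> H" using insert by simp
  then obtain n :: nat where n: "n > 0" "b [^] n = \<one>"
    using per HG unfolding periodic_group_def by blast
  have pow: "b [^] j \<in> H" for j :: nat
    using bH by (induction j) (auto simp: subgroup.one_closed[OF H] subgroup.m_closed[OF H])
  let ?K = "(\<lambda>(k, j::nat). k \<otimes> b [^] j) ` (K \<times> {..<n})"
  have "k \<otimes> b [^] j \<otimes> c \<in> ?K" if k: "k \<in> K" "j < n" and c: "c \<in> insert b B" for k j c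
  proof -
    have kG: "k \<in> carrier G" and bG: "b \<in> carrier G" and pG: "b [^] j \<in> carrier G"
      using K(2) k HG bH pow by auto
    show ?thesis
    proof (cases "c = b")
      case True
      have eq: "k \<otimes> b [^] j \<otimes> c = k \<otimes> b [^] Suc j" using True kG bG pG by (simp add: m_assoc)
      show ?thesis
      proof (cases "Suc j = n")
        case True
        then have "k \<otimes> b [^] Suc j = k \<otimes> b [^] (0::nat)" using n(2) by simp
        then show ?thesis using eq k n(1) by (intro image_eqI[of _ _ "(k, 0)"]) auto
      next
        case False
        then show ?thesis using eq k by (intro image_eqI[of _ _ "(k, Suc j)"]) auto
      qed
    next
      case False
      then have cB: "c \<in> B" using c by simp
      then have cH: "c \<in> H" using insert.prems by auto
      have "k \<otimes> b [^] j \<otimes> c = k \<otimes> c \<otimes> b [^] j"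
        using kG pG HG[OF cH] comm[OF pow cH] by (simp add: m_assoc)
      then show ?thesis using bspec[OF bspec[OF K(4) k(1)] cB] k(2) by (intro image_eqI[of _ _ "(k \<otimes> c, j)"]) auto
    qed
  qed
  moreover have "?K \<subseteq> H" using K(2) pow subgroup.m_closed[OF H] by auto
  moreover have "\<one> \<in> ?K" using K(3) n(1) by (intro image_eqI[of _ _ "(\<one>, 0)"]) auto
  moreover have "finite ?K" using K(1) by simp
  ultimately show ?case by (intro exI[of _ ?K]) auto
qed

text \<open>
  Right multiplication by a generator permutes the finite set \<open>X\<close>, so \<open>X\<close> is also closed under
  multiplication by inverses of generators.
\<close>

lemma (in group) finite_right_closed_generate:
  assumes X: "finite X" "X \<subseteq> carrier G" and A: "A \<subseteq> carrier G"
    and closed: "\<And>x a. x \<in> X \<Longrightarrow> a \<in> A \<Longrightarrow> x \<otimes> a \<in> X"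
    and g: "g \<in> generate G A" and x: "x \<in> X"
  shows "x \<otimes> g \<in> X"
  using g x
proof (induction arbitrary: x rule: generate.induct)
  case one then show ?case using X(2) by auto
next
  case (incl a) then show ?case using closed by blast
next
  case (inv a)
  have aG: "a \<in> carrier G" using inv A by blast
  have "inj_on (\<lambda>y. y \<otimes> a) X" using aG X(2) by (intro inj_onI) (auto simp: subset_iff)
  moreover have "(\<lambda>y. y \<otimes> a) ` X \<subseteq> X" using closed inv by auto
  ultimately have "(\<lambda>y. y \<otimes> a) ` X = X" using X(1) by (simp add: endo_inj_surj)
  then obtain y where y: "y \<in> X" "x = y \<otimes> a" using inv.prems by blast
  then have "x \<otimes> inv a = y" using aG X(2) by (auto simp: m_assoc subset_iff)
  then show ?case using y by simp
next
  case (eng g h)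
  have "g \<in> carrier G" "h \<in> carrier G" "x \<in> carrier G"
    using eng generate_in_carrier[OF A] X(2) by auto
  then show ?case using eng.IH(2)[OF eng.IH(1)[OF eng.prems]] by (simp add: m_assoc)
qed

text \<open>
  A short form of Schreier's argument. For a finite transversal \<open>T\<close> and generators \<open>a\<close> write
  \<open>t a = h t'\<close> with \<open>h \<in> H\<close>. The finitely many \<open>h\<close> lie in a finite set \<open>K\<close> that absorbs them, as \<open>H\<close> is
  abelian and periodic. Then \<open>K T\<close> is a finite set that is stable under the generators.
\<close>

lemma (in group) finite_if_abelian_finite_index:
  assumes fg: "finitely_generated_group G" and per: "periodic_group G" and H: "subgroup H G"
    and comm: "\<And>a b. a \<in> H \<Longrightarrow> b \<in> H \<Longrightarrow> a \<otimes> b = b \<otimes> a"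
    and index: "finite (rcosets H)"
  shows "finite (carrier G)"
proof -
  obtain A where A: "finite A" "A \<subseteq> carrier G" "generate G A = carrier G"
    using fg unfolding finitely_generated_group_def by blast
  define rep where "rep C = (SOME t. t \<in> carrier G \<and> C = H #> t)" for C
  define T where "T = rep ` (rcosets H)"
  have finT: "finite T" unfolding T_def using index by simp
  have rep: "rep C \<in> carrier G" "C = H #> rep C" if "C \<in> rcosets H" for C
    using someI_ex[of "\<lambda>t. t \<in> carrier G \<and> C = H #> t"] that unfolding rep_def RCOSETS_def by blast+
  have TG: "T \<subseteq> carrier G" using rep(1) by (auto simp: T_def)
  have trans: "\<exists>t\<in>T. g \<otimes> inv t \<in> H" if g: "g \<in> carrier G" for g
  proof -
    have C: "H #> g \<in> rcosets H" using g subgroup.subset[OF H] by (simp add: rcosetsI)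
    have "g \<in> H #> rep (H #> g)" using rcos_self[OF g H] rep(2)[OF C] by simp
    then obtain h where h: "h \<in> H" "g = h \<otimes> rep (H #> g)" unfolding r_coset_def by blast
    have "rep (H #> g) \<in> T" using C by (simp add: T_def)
    moreover have "g \<otimes> inv rep (H #> g) = h"
      using inv_solve_right'[OF subgroup.mem_carrier[OF H h(1)] g rep(1)[OF C]] h(2) by blast
    ultimately show ?thesis using h(1) by blast
  qed
  let ?B = "H \<inter> (\<lambda>(t, a, t'). t \<otimes> a \<otimes> inv t') ` (T \<times> A \<times> T)"
  have "finite ?B" using finT A(1) by (intro finite_Int disjI2 finite_imageI finite_cartesian_product)
  from finite_right_closed_subset[OF per H _ this Int_lower1] comm
  obtain K where K: "finite K" "K \<subseteq> H" "\<one> \<in> K" "\<forall>k\<in>K. \<forall>b\<in>?B. k \<otimes> b \<in> K"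
    by metis
  let ?X = "(\<lambda>(k, t). k \<otimes> t) ` (K \<times> T)"
  have KG: "K \<subseteq> carrier G" using K(2) subgroup.subset[OF H] by blast
  have X: "finite ?X" "?X \<subseteq> carrier G" using K(1) finT KG TG by auto
  have closed: "x \<otimes> a \<in> ?X" if "x \<in> ?X" "a \<in> A" for x a
  proof -
    obtain k t where kt: "k \<in> K" "t \<in> T" "x = k \<otimes> t" using \<open>x \<in> ?X\<close> by auto
    have G: "k \<in> carrier G" "t \<in> carrier G" "a \<in> carrier G" using kt KG TG A(2) that by auto
    obtain t' where t': "t' \<in> T" "t \<otimes> a \<otimes> inv t' \<in> H" using trans[of "t \<otimes> a"] G by auto
    have t'G: "t' \<in> carrier G" using t' TG by auto
    have "t \<otimes> a \<otimes> inv t' \<in> ?B" using t' kt that by force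
    then have "k \<otimes> (t \<otimes> a \<otimes> inv t') \<in> K" using K(4) kt by blast
    moreover have "x \<otimes> a = k \<otimes> (t \<otimes> a \<otimes> inv t') \<otimes> t'" using G t'G kt by (simp add: m_assoc)
    ultimately show ?thesis using t' by (intro image_eqI[of _ _ "(k \<otimes> (t \<otimes> a \<otimes> inv t'), t')"]) auto
  qed
  obtain x where x: "x \<in> ?X" using trans[OF one_closed] K(3) by force
  have "(\<lambda>g. x \<otimes> g) ` carrier G \<subseteq> ?X"
    using finite_right_closed_generate[OF X A(2) closed _ x] A(3) by auto
  moreover have "inj_on (\<lambda>g. x \<otimes> g) (carrier G)" using x X(2) by (intro inj_onI) (auto simp: subset_iff)
  ultimately show ?thesis using X(1) by (meson finite_imageD finite_subset)
qed

section \<open>From the sphere to its cone\<close>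

definition cone_ext :: "(real^3 \<Rightarrow> real^3) \<Rightarrow> real^3 \<Rightarrow> real^3" where
  "cone_ext f y = norm y *\<^sub>R f (y /\<^sub>R norm y)"

lemma cone_ext_unit: "norm x = 1 \<Longrightarrow> cone_ext f x = f x"
  by (simp add: cone_ext_def)

lemma unit_normalize: "y \<noteq> 0 \<Longrightarrow> y /\<^sub>R norm y \<in> S2"
  by simp

lemma cone_ext_norm:
  assumes "f ` S2 \<subseteq> S2" shows "norm (cone_ext f y) = norm y"
proof (cases "y = 0")
  case False
  then have "f (y /\<^sub>R norm y) \<in> S2" using assms unit_normalize by blast
  then show ?thesis by (simp add: cone_ext_def)
qed (simp add: cone_ext_def)

lemma cone_ext_scale: "t \<ge> 0 \<Longrightarrow> cone_ext f (t *\<^sub>R y) = t *\<^sub>R cone_ext f y"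
proof (cases "t = 0")
  case False
  then have "inverse (t * norm y) * t = inverse (norm y)" by simp
  moreover assume t: "t \<ge> 0"
  ultimately have eq: "(t *\<^sub>R y) /\<^sub>R norm (t *\<^sub>R y) = y /\<^sub>R norm y"
    unfolding norm_scaleR scaleR_scaleR by (simp only: abs_of_nonneg)
  show ?thesis unfolding cone_ext_def eq using t by simp
qed (simp add: cone_ext_def)

lemma cone_ext_compose:
  assumes "g ` S2 \<subseteq> S2" shows "cone_ext (compose S2 f g) = cone_ext f \<circ> cone_ext g"
proof
  fix y :: "real^3"
  show "cone_ext (compose S2 f g) y = (cone_ext f \<circ> cone_ext g) y"
  proof (cases "y = 0")
    case False
    then have "y /\<^sub>R norm y \<in> S2" by (rule unit_normalize)
    moreover have "cone_ext g y /\<^sub>R norm y = g (y /\<^sub>R norm y)" using False by (simp add: cone_ext_def)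
    ultimately show ?thesis
      unfolding o_apply cone_ext_def[of f] cone_ext_def[of "compose S2 f g"] cone_ext_norm[OF assms]
      by (simp only: compose_eq)
  qed (simp add: cone_ext_def)
qed

lemma cone_ext_id: "cone_ext (\<lambda>x\<in>S2. x) = id"
proof
  fix y show "cone_ext (\<lambda>x\<in>S2. x) y = id y"
    using unit_normalize[of y] by (cases "y = 0") (auto simp: cone_ext_def)
qed

lemma cone_ext_inject:
  assumes "cone_ext f = cone_ext g" "f \<in> extensional S2" "g \<in> extensional S2"
  shows "f = g"
  using assms(2,3)
proof (rule extensionalityI)
  fix x assume "x \<in> S2"
  then show "f x = g x" using cone_ext_unit[of x f] cone_ext_unit[of x g] assms(1) by simp
qed

lemma C1_on_normalize: "C1_on (- {0}) (\<lambda>y::'a::euclidean_space. y /\<^sub>R norm y)"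
  by (intro C1_on_scaleR C1_on_compose[OF C1_on_norm C1_on_inverse] C1_on_id) auto

lemma C1_on_cone_ext:
  assumes "C1_on S2 f" shows "C1_on (- {0}) (cone_ext f)"
proof -
  have "C1_on (- {0}) (\<lambda>y. f (y /\<^sub>R norm y))"
    using unit_normalize by (intro C1_on_compose[OF C1_on_normalize assms]) blast
  then show ?thesis unfolding cone_ext_def[abs_def] by (intro C1_on_scaleR C1_on_norm)
qed

lemma normalize_has_derivative:
  fixes x :: "'a::euclidean_space"
  assumes "norm x = 1"
  shows "((\<lambda>y. y /\<^sub>R norm y) has_derivative (\<lambda>v. v - (x \<bullet> v) *\<^sub>R x)) (at x)"
proof -
  have x0: "x \<noteq> 0" using assms by auto
  have N: "(norm has_derivative (\<lambda>v. v \<bullet> sgn x)) (at x)" by (rule has_derivative_norm[OF x0])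
  have "((\<lambda>y. inverse (norm y)) has_derivative (\<lambda>v. - (inverse (norm x) * (v \<bullet> sgn x) * inverse (norm x)))) (at x)"
    by (rule Deriv.has_derivative_inverse[OF _ N]) (use x0 in simp)
  from has_derivative_scaleR[OF this has_derivative_ident]
  show ?thesis using assms by (simp add: sgn_div_norm inner_commute)
qed

lemma cone_ext_has_derivative:
  assumes x: "norm x = 1" and D: "(f has_derivative D) (at x within S2)"
  shows "(cone_ext f has_derivative (\<lambda>v. D (v - (x \<bullet> v) *\<^sub>R x) + (x \<bullet> v) *\<^sub>R f x)) (at x)"
proof -
  have x0: "x \<in> - {0}" using x by auto
  have op: "at x within - {0} = at x" using x0 by (intro at_within_open) auto
  have "((\<lambda>y. y /\<^sub>R norm y) has_derivative (\<lambda>v. v - (x \<bullet> v) *\<^sub>R x)) (at x within - {0})"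
    by (rule has_derivative_at_withinI[OF normalize_has_derivative[OF x]])
  moreover have "(f has_derivative D) (at (x /\<^sub>R norm x) within (\<lambda>y. y /\<^sub>R norm y) ` (- {0}))"
  proof (rule has_derivative_subset)
    show "(f has_derivative D) (at (x /\<^sub>R norm x) within S2)" using x D by simp
    show "(\<lambda>y. y /\<^sub>R norm y) ` (- {0}) \<subseteq> S2" using unit_normalize by blast
  qed
  ultimately have "((\<lambda>y. f (y /\<^sub>R norm y)) has_derivative (\<lambda>v. D (v - (x \<bullet> v) *\<^sub>R x))) (at x within - {0})"
    by (rule has_derivative_in_compose)
  then have 1: "((\<lambda>y. f (y /\<^sub>R norm y)) has_derivative (\<lambda>v. D (v - (x \<bullet> v) *\<^sub>R x))) (at x)"
    unfolding op .
  have "(norm has_derivative (\<lambda>v. v \<bullet> sgn x)) (at x)" using x0 by (intro has_derivative_norm) auto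
  from has_derivative_scaleR[OF this 1]
  show ?thesis unfolding cone_ext_def[abs_def] using x by (simp add: sgn_div_norm inner_commute)
qed

text \<open>
  By homogeneity it suffices to consider unit vectors \<open>x\<close>. There \<open>D\<close> maps \<open>x\<close> to \<open>f x\<close> and agrees on the
  tangent plane with the derivative of \<open>f\<close>, so its determinant is the one that defines
  preservation of orientation.
\<close>

lemma cone_ext_det_pos:
  assumes f: "orientation_preserving f" and y: "y \<noteq> 0" and D: "(cone_ext f has_derivative D) (at y)"
  shows "det (matrix D) > 0"
proof -
  define x where "x = y /\<^sub>R norm y"
  have x: "norm x = 1" using y by (simp add: x_def)
  have yx: "norm y *\<^sub>R x = y" using y by (simp add: x_def)
  have linD: "linear D" using D by (rule has_derivative_linear)
  have Dx: "(cone_ext f has_derivative D) (at x)"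
  proof -
    have "((\<lambda>z. norm y *\<^sub>R z) has_derivative (\<lambda>v. norm y *\<^sub>R v)) (at x)"
      by (intro has_derivative_scaleR_right has_derivative_ident)
    then have "((\<lambda>z. cone_ext f (norm y *\<^sub>R z)) has_derivative (\<lambda>v. D (norm y *\<^sub>R v))) (at x)"
      by (rule has_derivative_compose) (simp only: yx D)
    from has_derivative_scaleR_right[OF this, of "inverse (norm y)"]
    show ?thesis using y by (simp add: cone_ext_scale linear_scale[OF linD])
  qed
  obtain E where E: "(f has_derivative E) (at x within S2)"
    and pos: "\<And>u v. u \<bullet> x = 0 \<Longrightarrow> v \<bullet> x = 0 \<Longrightarrow> det (vector [x, u, v] :: real^3^3) > 0 \<Longrightarrow>
           det (vector [f x, E u, E v] :: real^3^3) > 0"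
    using f x unfolding orientation_preserving_def by force
  have D_eq: "D = (\<lambda>v. E (v - (x \<bullet> v) *\<^sub>R x) + (x \<bullet> v) *\<^sub>R f x)"
    by (rule has_derivative_unique[OF Dx cone_ext_has_derivative[OF x E]])
  have "E 0 = 0" using has_derivative_linear[OF E] linear_0 by blast
  then have 1: "D x = f x" unfolding D_eq using x by (simp add: dot_square_norm)
  have 2: "D u = E u" if "u \<bullet> x = 0" for u
    unfolding D_eq using that by (simp add: inner_commute)
  let ?e = "\<lambda>i::3. axis i (1::real)"
  obtain R where R: "orthogonal_transformation R" "det (matrix R) = 1" "R (?e 3) = x"
    using rotation_exists_1[of "?e 3" x] x by auto
  have linR: "linear R" using R by (simp add: orthogonal_transformation)
  have orth: "R (?e i) \<bullet> x = 0" if "i \<noteq> 3" for i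
    using R(1) that unfolding R(3)[symmetric] orthogonal_transformation_def by (simp add: inner_axis_axis)
  have "det (vector [?e 3, ?e 1, ?e 2] :: real^3^3) = 1" by (simp add: det_3 axis_def)
  then have det1: "det (vector [x, R (?e 1), R (?e 2)] :: real^3^3) = 1"
    unfolding R(3)[symmetric] det_rows_image[OF linR] using R(2) by simp
  have "0 < det (vector [f x, E (R (?e 1)), E (R (?e 2))] :: real^3^3)"
    by (intro pos orth) (simp_all add: det1)
  also have "\<dots> = det (vector [D x, D (R (?e 1)), D (R (?e 2))] :: real^3^3)"
    by (simp add: 1 2 orth)
  also have "\<dots> = det (matrix D)" unfolding det_rows_image[OF linD] det1 by simp
  finally show ?thesis .
qed

lemma conical_cone_ext:
  assumes "f \<in> C1_diffeos S2" "orientation_preserving f"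
  shows "conical (cone_ext f)"
proof -
  have "f ` S2 \<subseteq> S2" using assms(1) by (auto simp: C1_diffeos_def Bij_def bij_betw_def)
  moreover have "C1_on S2 f" using assms(1) by (simp add: C1_diffeos_def)
  ultimately show ?thesis
    unfolding conical_def
    using cone_ext_norm cone_ext_scale C1_on_cone_ext cone_ext_det_pos[OF assms(2)] by blast
qed

section \<open>Finiteness of the group\<close>

lemma finite_order_imp_bij:
  assumes "h ^^ n = id" "n > 0" shows "bij h"
proof -
  have "h \<circ> h ^^ (n - 1) = id" "h ^^ (n - 1) \<circ> h = id"
    using assms by (metis Suc_diff_1 funpow.simps(2), metis Suc_diff_1 funpow_Suc_right)
  then show ?thesis by (metis o_bij)
qed

lemma finite_image_factor:
  assumes "finite (p ` A)" "\<And>a b. a \<in> A \<Longrightarrow> b \<in> A \<Longrightarrow> p a = p b \<Longrightarrow> F a = F b"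
  shows "finite (F ` A)"
proof -
  have "F a = F (inv_into A p (p a))" if "a \<in> A" for a
    using that by (intro assms(2)) (auto intro: inv_into_into simp: f_inv_into_f)
  then have "F ` A \<subseteq> (F \<circ> inv_into A p) ` (p ` A)" by force
  then show ?thesis using assms(1) finite_surj by blast
qed

theorem corollary5:
  fixes \<Gamma> :: "(real^3 \<Rightarrow> real^3) set"
  assumes "subgroup \<Gamma> (Diff1 S2)"
    and "\<forall>f\<in>\<Gamma>. orientation_preserving f"
    and "finitely_generated_group ((Diff1 S2)\<lparr>carrier := \<Gamma>\<rparr>)"
    and "periodic_group ((Diff1 S2)\<lparr>carrier := \<Gamma>\<rparr>)"
    and "group_center ((Diff1 S2)\<lparr>carrier := \<Gamma>\<rparr>) \<noteq> {\<one>\<^bsub>Diff1 S2\<^esub>}"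
  shows "finite \<Gamma>"
proof -
  define G where "G = (Diff1 S2)\<lparr>carrier := \<Gamma>\<rparr>"
  interpret G: group G
    unfolding G_def using group.subgroup_imp_group[OF group_Diff1 assms(1)] .
  have carrier: "carrier G = \<Gamma>" by (simp add: G_def)
  have \<Gamma>: "f \<in> C1_diffeos S2" if "f \<in> \<Gamma>" for f
    using subgroup.mem_carrier[OF assms(1) that] by (simp add: Diff1_def)
  have bij: "f \<in> extensional S2" "bij_betw f S2 S2" if "f \<in> \<Gamma>" for f
    using \<Gamma>[OF that] by (auto simp: C1_diffeos_def Bij_def)
  have maps: "f ` S2 \<subseteq> S2" "f x \<in> S2" if "f \<in> \<Gamma>" "x \<in> S2" for f x
    using bij(2)[OF that(1)] that(2) by (auto simp: bij_betw_def)
  have mult: "f \<otimes>\<^bsub>G\<^esub> g = compose S2 f g" if "f \<in> \<Gamma>" "g \<in> \<Gamma>" for f g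
    using \<Gamma> that by (simp add: G_def Diff1_def BijGroup_def C1_diffeos_def)
  have one: "\<one>\<^bsub>G\<^esub> = (\<lambda>x\<in>S2. x)" by (simp add: G_def Diff1_def BijGroup_def)
  have mult_at: "(f \<otimes>\<^bsub>G\<^esub> g) x = f (g x)" if "f \<in> \<Gamma>" "g \<in> \<Gamma>" "x \<in> S2" for f g x
    using that by (simp add: mult compose_def)
  have cone_mult: "cone_ext (f \<otimes>\<^bsub>G\<^esub> g) = cone_ext f \<circ> cone_ext g" if "f \<in> \<Gamma>" "g \<in> \<Gamma>" for f g
    unfolding mult[OF that] by (rule cone_ext_compose) (use maps that in blast)
  have cone_one: "cone_ext \<one>\<^bsub>G\<^esub> = id" unfolding one by (rule cone_ext_id)
  have cone_inj: "f = g" if "cone_ext f = cone_ext g" "f \<in> \<Gamma>" "g \<in> \<Gamma>" for f g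
    using cone_ext_inject that bij(1) by blast
  have conical: "conical (cone_ext f)" if "f \<in> \<Gamma>" for f
    using conical_cone_ext \<Gamma> that assms(2) by blast
  have order: "\<exists>n>0. cone_ext f ^^ n = id" if f: "f \<in> \<Gamma>" for f
  proof -
    obtain n :: nat where n: "n > 0" "f [^]\<^bsub>G\<^esub> n = \<one>\<^bsub>G\<^esub>"
      using assms(4) f unfolding periodic_group_def G_def by auto
    have "f [^]\<^bsub>G\<^esub> k \<in> \<Gamma> \<and> cone_ext (f [^]\<^bsub>G\<^esub> k) = cone_ext f ^^ k" for k :: nat
    proof (induction k)
      case 0 show ?case using cone_one carrier G.one_closed by (simp add: id_def)
    next
      case (Suc k)
      then show ?case
        using cone_mult[of "f [^]\<^bsub>G\<^esub> k" f] f G.m_closed carrier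
        by (simp add: funpow_Suc_right del: funpow.simps)
    qed
    then show ?thesis using n cone_one by metis
  qed
  have one_center: "\<one>\<^bsub>G\<^esub> \<in> group_center G" by (simp add: group_center_def)
  moreover have "group_center G \<noteq> {\<one>\<^bsub>G\<^esub>}" using assms(5) by (simp add: G_def)
  ultimately obtain c where c: "c \<in> group_center G" "c \<noteq> \<one>\<^bsub>G\<^esub>" by blast
  then have central: "c \<otimes>\<^bsub>G\<^esub> g = g \<otimes>\<^bsub>G\<^esub> c" if "g \<in> \<Gamma>" for g
    using that by (auto simp: group_center_def carrier)
  have c\<Gamma>: "c \<in> \<Gamma>" using c by (auto simp: group_center_def carrier)
  \<comment> \<open>The fixed points of the central element \<open>c\<close> form a finite \<open>\<Gamma>\<close>-invariant set, so the stabiliser of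
    one of them has finite index.\<close>
  define F where "F = {x \<in> S2. c x = x}"
  obtain n where n: "n > 0" "cone_ext c ^^ n = id" using order[OF c\<Gamma>] by blast
  have Fcone: "F = {x \<in> sphere 0 1. cone_ext c x = x}" unfolding F_def by (auto simp: cone_ext_unit)
  have "cone_ext c \<noteq> id" using cone_inj[of c "\<one>\<^bsub>G\<^esub>"] cone_one c(2) c\<Gamma> G.one_closed carrier by auto
  then have finF: "finite F"
    unfolding Fcone by (rule finite_order_fixed_points_finite[OF conical[OF c\<Gamma>] n])
  obtain x where x: "x \<in> F"
    using conical_has_fixed_point[OF conical[OF c\<Gamma>] finite_order_imp_bij[OF n(2,1)]] unfolding Fcone by blast
  have xS: "x \<in> S2" "norm x = 1" using x by (auto simp: F_def)
  have invF: "g x \<in> F" if "g \<in> \<Gamma>" for g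
    using mult_at[OF c\<Gamma> that xS(1)] mult_at[OF that c\<Gamma> xS(1)] central[OF that] x maps(2)[OF that xS(1)]
    unfolding F_def by simp
  define H where "H = {g \<in> \<Gamma>. g x = x}"
  have inv_at: "(inv\<^bsub>G\<^esub> g) (g x) = x" if "g \<in> \<Gamma>" for g
    using mult_at[of "inv\<^bsub>G\<^esub> g" g x] that xS carrier G.inv_closed[of g] G.l_inv[of g] one by simp
  have H: "subgroup H G"
  proof (rule G.subgroupI)
    show "H \<subseteq> carrier G" by (auto simp: H_def carrier)
    show "H \<noteq> {}" using G.one_closed xS by (auto simp: H_def carrier one intro!: exI[of _ "\<lambda>x\<in>S2. x"])
    show "inv\<^bsub>G\<^esub> g \<in> H" if "g \<in> H" for g
      using that inv_at[of g] G.inv_closed[of g] by (auto simp: H_def carrier)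
    show "f \<otimes>\<^bsub>G\<^esub> g \<in> H" if "f \<in> H" "g \<in> H" for f g
      using that mult_at[of f g x] xS G.m_closed[of f g] by (auto simp: H_def carrier)
  qed
  have "finite (carrier G)"
  proof (rule G.finite_if_abelian_finite_index[OF _ _ H])
    show "finitely_generated_group G" "periodic_group G" using assms(3,4) by (simp_all add: G_def)
    obtain J \<pi> where "tangent_frame x J \<pi>" using tangent_frame_exists[OF xS(2)] by blast
    then interpret tangent_frame x J \<pi> .
    show "a \<otimes>\<^bsub>G\<^esub> b = b \<otimes>\<^bsub>G\<^esub> a" if a: "a \<in> H" and b: "b \<in> H" for a b
    proof -
      define k where "k = a \<otimes>\<^bsub>G\<^esub> b \<otimes>\<^bsub>G\<^esub> inv\<^bsub>G\<^esub> (b \<otimes>\<^bsub>G\<^esub> a)"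
      have ab: "a \<otimes>\<^bsub>G\<^esub> b \<in> H" "b \<otimes>\<^bsub>G\<^esub> a \<in> H" using a b H subgroup.m_closed by metis+
      then have k: "k \<in> H" unfolding k_def using H subgroup.m_closed subgroup.m_inv_closed by metis
      have HG: "g \<in> \<Gamma>" "cone_ext g x = x" if "g \<in> H" for g
        using that xS by (auto simp: H_def cone_ext_unit)
      have "k \<otimes>\<^bsub>G\<^esub> (b \<otimes>\<^bsub>G\<^esub> a) = a \<otimes>\<^bsub>G\<^esub> b"
        using G.inv_solve_right'[of k] HG(1)[OF k] HG(1)[OF ab(1)] HG(1)[OF ab(2)]
        unfolding carrier by (metis k_def)
      from arg_cong[OF this, of cone_ext]
      have kba: "cone_ext k \<circ> cone_ext b \<circ> cone_ext a = cone_ext a \<circ> cone_ext b"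
        using cone_mult[OF HG(1)[OF k] HG(1)[OF ab(2)]] cone_mult[OF HG(1)[OF a] HG(1)[OF b]]
          cone_mult[OF HG(1)[OF b] HG(1)[OF a]] by (simp add: o_assoc)
      obtain na nb nk where "na > 0" "cone_ext a ^^ na = id" "nb > 0" "cone_ext b ^^ nb = id"
        "nk > 0" "cone_ext k ^^ nk = id"
        using order HG(1) a b k by metis
      then have "cone_ext a \<circ> cone_ext b = cone_ext b \<circ> cone_ext a"
        using finite_order_commute[OF conical[OF HG(1)[OF a]] HG(2)[OF a] _ _ conical[OF HG(1)[OF b]] HG(2)[OF b] _ _
          conical[OF HG(1)[OF k]] HG(2)[OF k] _ _ kba] by blast
      then have "cone_ext (a \<otimes>\<^bsub>G\<^esub> b) = cone_ext (b \<otimes>\<^bsub>G\<^esub> a)"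
        using cone_mult HG(1) a b by metis
      then show ?thesis using cone_inj HG(1) ab by blast
    qed
    \<comment> \<open>A right coset of the stabiliser is determined by the image of \<open>x\<close> under the inverse.\<close>
    have "finite ((\<lambda>g. H #>\<^bsub>G\<^esub> g) ` \<Gamma>)"
    proof (rule finite_image_factor)
      have "(\<lambda>g. (inv\<^bsub>G\<^esub> g) x) ` \<Gamma> \<subseteq> F" using invF G.inv_closed carrier by auto
      then show "finite ((\<lambda>g. (inv\<^bsub>G\<^esub> g) x) ` \<Gamma>)" using finF finite_subset by blast
      fix f g assume fg: "f \<in> \<Gamma>" "g \<in> \<Gamma>" "(inv\<^bsub>G\<^esub> f) x = (inv\<^bsub>G\<^esub> g) x"
      have ig: "inv\<^bsub>G\<^esub> g \<in> \<Gamma>" "inv\<^bsub>G\<^esub> f \<in> \<Gamma>" using fg G.inv_closed carrier by auto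
      have "(f \<otimes>\<^bsub>G\<^esub> inv\<^bsub>G\<^esub> g) x = f ((inv\<^bsub>G\<^esub> f) x)"
        using mult_at[OF fg(1) ig(1) xS(1)] fg(3) by simp
      also have "\<dots> = x"
        using mult_at[OF fg(1) ig(2) xS(1)] G.r_inv[of f] fg(1) carrier one xS(1) by simp
      finally have fg': "f \<otimes>\<^bsub>G\<^esub> inv\<^bsub>G\<^esub> g \<in> H" using fg ig G.m_closed carrier by (auto simp: H_def)
      then have "H #>\<^bsub>G\<^esub> (f \<otimes>\<^bsub>G\<^esub> inv\<^bsub>G\<^esub> g) = H" 
        using G.coset_join2[OF _ H] subgroup.mem_carrier[OF H] by blast
      then show "H #>\<^bsub>G\<^esub> f = H #>\<^bsub>G\<^esub> g"
        using fg G.coset_mult_inv1[of H f g] subgroup.subset[OF H] carrier by auto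
    qed
    then show "finite (rcosets\<^bsub>G\<^esub> H)"
      unfolding RCOSETS_def carrier by (simp add: UNION_singleton_eq_range)
  qed
  then show ?thesis by (simp add: carrier)
qed

end
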